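(* There are exactly $41$ $(2,2)$-BM groups up to isomorphism.
   Context: Let $\alpha,\beta$ be positive integers, $A_{\alpha}=\{a_1,\ldots,a_{\alpha}\}$, $B_{\beta}=\{b_1,\ldots,b_{\beta}\}$ (disjoint sets of letters), and let $A_{\alpha}^{\pm1}$, $B_{\beta}^{\pm1}$ be the sets of $2\alpha$, respectively $2\beta$, distinct formal symbols consisting of the letters and their formal inverses, with $(x^{-1})^{-1}=x$. For $a,a'\in A_{\alpha}^{\pm1}$ and $b,b'\in B_{\beta}^{\pm1}$ the geometric square $[aba'b']$ is the set of words \[ [aba'b'] := \{aba'b',\; a'b'ab,\; a^{-1}b'^{-1}a'^{-1}b^{-1},\; a'^{-1}b^{-1}a^{-1}b'^{-1}\}. \] $GS_{\alpha,\beta}$ denotes the set of all geometric squares $[aba'b']$ with $a,a'\in A_{\alpha}^{\pm1}$, $b,b'\in B_{\beta}^{\pm1}$. For $S\subseteq GS_{\alpha,\beta}$ the link $Lk(S)$ is the undirected simple graph with vertex set $A_{\alpha}^{\pm1}\sqcup B_{\beta}^{\pm1}$ and edges $\{a^{-1},b\}$, $\{a',b^{-1}\}$, $\{a'^{-1},b'\}$, $\{a,b'^{-1}\}$ for each $[aba'b']\in S$. An $(\alpha,\beta)$-BM relation is a set $R\subseteq GS_{\alpha,\beta}$ consisting of exactly $\alpha\beta$ geometric squares such that $Lk(R)$ is the complete bipartite graph $K_{2\alpha,2\beta}$ with respect to the decomposition $A_{\alpha}^{\pm1}\sqcup B_{\beta}^{\pm1}$. An $(\alpha,\beta)$-BM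 group is a group with a presentation $\langle A_{\alpha}\cup B_{\beta}\mid R\rangle$ for some $(\alpha,\beta)$-BM relation $R$, where each geometric square $[aba'b']\in R$ gives the relator $aba'b'$ (all four words in the geometric square induce the same relation in the group). *)

theory Defs
  imports "HOL-Algebra.Group"
begin

text \<open>
  A letter is a generator together with a sign: \<open>(x, True)\<close> stands for \<open>x\<close> and
  \<open>(x, False)\<close> for its formal inverse.
\<close>

type_synonym 'x letter = "'x \<times> bool"

definition inv_letter :: "'x letter \<Rightarrow> 'x letter" where
  "inv_letter l = (fst l, \<not> snd l)"

definition letters :: "'x set \<Rightarrow> 'x letter set" where
  "letters X = X \<times> UNIV"

text \<open>
  The group \<open>\<langle>X | S\<rangle>\<close>, where \<open>S\<close> is a set of words over \<open>letters X\<close>: words modulo the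
  insertion and deletion of trivial pairs and of relators.
\<close>

inductive pres_equiv :: "'x set \<Rightarrow> 'x letter list set \<Rightarrow> 'x letter list \<Rightarrow> 'x letter list \<Rightarrow> bool"
  for X S where
  refl: "w \<in> lists (letters X) \<Longrightarrow> pres_equiv X S w w"
| sym: "pres_equiv X S u v \<Longrightarrow> pres_equiv X S v u"
| trans: "pres_equiv X S u v \<Longrightarrow> pres_equiv X S v w \<Longrightarrow> pres_equiv X S u w"
| cancel: "u \<in> lists (letters X) \<Longrightarrow> v \<in> lists (letters X) \<Longrightarrow> l \<in> letters X
    \<Longrightarrow> pres_equiv X S (u @ [l, inv_letter l] @ v) (u @ v)"
| relator: "u \<in> lists (letters X) \<Longrightarrow> v \<in> lists (letters X) \<Longrightarrow> r \<in> S \<Longrightarrow> r \<in> lists (letters X)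
    \<Longrightarrow> pres_equiv X S (u @ r @ v) (u @ v)"

definition pres_rel :: "'x set \<Rightarrow> 'x letter list set \<Rightarrow> ('x letter list \<times> 'x letter list) set" where
  "pres_rel X S = {(u, v). pres_equiv X S u v}"

definition presented_group :: "'x set \<Rightarrow> 'x letter list set \<Rightarrow> 'x letter list set monoid" where
  "presented_group X S =
    \<lparr>carrier = lists (letters X) // pres_rel X S,
     mult = (\<lambda>U V. \<Union>u\<in>U. \<Union>v\<in>V. pres_rel X S `` {u @ v}),
     one = pres_rel X S `` {[]}\<rparr>"

lemma pres_equiv_words:
  "pres_equiv X S u v \<Longrightarrow> u \<in> lists (letters X) \<and> v \<in> lists (letters X)"
  by (induction rule: pres_equiv.induct) (auto simp: letters_def inv_letter_def)

lemma pres_equiv_append_left: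
  "pres_equiv X S u v \<Longrightarrow> w \<in> lists (letters X) \<Longrightarrow> pres_equiv X S (w @ u) (w @ v)"
proof (induction rule: pres_equiv.induct)
  case (cancel u v l)
  then show ?case using pres_equiv.cancel[of "w @ u" X v l S] by simp
next
  case (relator u v r)
  then show ?case using pres_equiv.relator[of "w @ u" X v r S] by simp
next
  case (refl u)
  then show ?case by (simp add: pres_equiv.refl)
qed (blast intro: pres_equiv.sym pres_equiv.trans)+

lemma pres_equiv_append_right:
  "pres_equiv X S u v \<Longrightarrow> w \<in> lists (letters X) \<Longrightarrow> pres_equiv X S (u @ w) (v @ w)"
proof (induction rule: pres_equiv.induct)
  case (cancel u v l)
  then show ?case using pres_equiv.cancel[of u X "v @ w" l S] by simp
next
  case (relator u v r)
  then show ?case using pres_equiv.relator[of u X "v @ w" r S] by simp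
next
  case (refl u)
  then show ?case by (simp add: pres_equiv.refl)
qed (blast intro: pres_equiv.sym pres_equiv.trans)+

lemma equiv_pres_rel: "equiv (lists (letters X)) (pres_rel X S)"
proof (rule equivI)
  show "pres_rel X S \<subseteq> lists (letters X) \<times> lists (letters X)"
    using pres_equiv_words by (fastforce simp: pres_rel_def)
  show "refl_on (lists (letters X)) (pres_rel X S)"
    by (auto simp: refl_on_def pres_rel_def intro: pres_equiv.refl)
  show "sym_on UNIV (pres_rel X S)"
    by (auto simp: sym_def pres_rel_def intro: pres_equiv.sym)
  show "trans_on UNIV (pres_rel X S)"
    by (auto simp: trans_def pres_rel_def intro: pres_equiv.trans)
qed

lemma presented_group_mult:
  assumes "u \<in> lists (letters X)" "v \<in> lists (letters X)"
  shows "pres_rel X S `` {u} \<otimes>\<^bsub>presented_group X S\<^esub> pres_rel X S `` {v}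
    = pres_rel X S `` {u @ v}"
proof -
  have "congruent2 (pres_rel X S) (pres_rel X S) (\<lambda>u v. pres_rel X S `` {u @ v})"
  proof (rule congruent2I')
    fix u u' v v' assume "(u, u') \<in> pres_rel X S" "(v, v') \<in> pres_rel X S"
    then have "pres_equiv X S (u @ v) (u' @ v')"
      unfolding pres_rel_def
      by (metis (no_types, lifting) case_prodD mem_Collect_eq pres_equiv.trans
          pres_equiv_append_left pres_equiv_append_right pres_equiv_words)
    then show "pres_rel X S `` {u @ v} = pres_rel X S `` {u' @ v'}"
      by (intro equiv_class_eq[OF equiv_pres_rel]) (simp add: pres_rel_def)
  qed
  then show ?thesis
    unfolding presented_group_def
    using UN_equiv_class2[OF equiv_pres_rel equiv_pres_rel _ assms] by simp
qed

lemma inverse_word_exists: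
  "w \<in> lists (letters X) \<Longrightarrow> \<exists>w' \<in> lists (letters X). pres_equiv X S (w' @ w) []"
proof (induction w)
  case Nil
  then show ?case by (auto intro: pres_equiv.refl)
next
  case (Cons l w)
  then obtain w' where w': "w' \<in> lists (letters X)" "pres_equiv X S (w' @ w) []" by auto
  have l: "inv_letter l \<in> letters X" "inv_letter (inv_letter l) = l"
    using Cons.prems by (auto simp: letters_def inv_letter_def)
  have "pres_equiv X S (w' @ [inv_letter l, l] @ w) (w' @ w)"
    using pres_equiv.cancel[of w' X w "inv_letter l" S] Cons.prems w' l by simp
  then have "pres_equiv X S ((w' @ [inv_letter l]) @ l # w) []"
    using w' pres_equiv.trans by fastforce
  then show ?case using w' l by (metis append_in_lists_conv lists.simps)
qed

lemma group_presented_group: "group (presented_group X S)"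
proof (rule groupI)
  let ?W = "lists (letters X)" and ?P = "presented_group X S" and ?c = "\<lambda>u. pres_rel X S `` {u}"
  have carrier: "carrier ?P = ?c ` ?W"
    by (auto simp: presented_group_def quotient_def)
  have one: "\<one>\<^bsub>?P\<^esub> = ?c []" by (simp add: presented_group_def)
  note mult = presented_group_mult[of _ X _ S]
  show "\<one>\<^bsub>?P\<^esub> \<in> carrier ?P" by (auto simp: carrier one)
  show "x \<otimes>\<^bsub>?P\<^esub> y \<in> carrier ?P" if xy: "x \<in> carrier ?P" "y \<in> carrier ?P" for x y
  proof -
    obtain u v where "u \<in> ?W" "v \<in> ?W" "x = ?c u" "y = ?c v" using xy carrier by auto
    then show ?thesis using mult[of u v] carrier by (metis append_in_lists_conv imageI)
  qed
  show "x \<otimes>\<^bsub>?P\<^esub> y \<otimes>\<^bsub>?P\<^esub> z = x \<otimes>\<^bsub>?P\<^esub> (y \<otimes>\<^bsub>?P\<^esub> z)"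
    if xyz: "x \<in> carrier ?P" "y \<in> carrier ?P" "z \<in> carrier ?P" for x y z
  proof -
    obtain u v w where "u \<in> ?W" "v \<in> ?W" "w \<in> ?W" "x = ?c u" "y = ?c v" "z = ?c w"
      using xyz carrier by auto
    then show ?thesis using mult by (simp add: append_in_lists_conv del: in_lists_conv_set)
  qed
  show "\<one>\<^bsub>?P\<^esub> \<otimes>\<^bsub>?P\<^esub> x = x" if "x \<in> carrier ?P" for x
    using that mult[of "[]"] by (auto simp: carrier one simp del: in_lists_conv_set)
  show "\<exists>y\<in>carrier ?P. y \<otimes>\<^bsub>?P\<^esub> x = \<one>\<^bsub>?P\<^esub>" if x: "x \<in> carrier ?P" for x
  proof -
    obtain w where w: "w \<in> ?W" "x = ?c w" using x carrier by auto
    obtain w' where w': "w' \<in> ?W" "pres_equiv X S (w' @ w) []"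
      using inverse_word_exists w by blast
    have "?c w' \<otimes>\<^bsub>?P\<^esub> x = \<one>\<^bsub>?P\<^esub>"
      using w w' equiv_class_eq[OF equiv_pres_rel] mult[of w' w] by (simp add: one pres_rel_def)
    then show ?thesis using w' carrier by blast
  qed
qed

datatype gen = GenA nat | GenB nat

definition A_gens :: "nat \<Rightarrow> gen set" where
  "A_gens \<alpha> = GenA ` {1..\<alpha>}"

definition B_gens :: "nat \<Rightarrow> gen set" where
  "B_gens \<beta> = GenB ` {1..\<beta>}"

definition geometric_square ::
    "gen letter \<Rightarrow> gen letter \<Rightarrow> gen letter \<Rightarrow> gen letter \<Rightarrow> gen letter list set" where
  "geometric_square a b a' b' =
    {[a, b, a', b'],
     [a', b', a, b],
     [inv_letter a, inv_letter b', inv_letter a', inv_letter b],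
     [inv_letter a', inv_letter b, inv_letter a, inv_letter b']}"

definition GS :: "nat \<Rightarrow> nat \<Rightarrow> gen letter list set set" where
  "GS \<alpha> \<beta> = {geometric_square a b a' b' | a b a' b'.
     a \<in> letters (A_gens \<alpha>) \<and> a' \<in> letters (A_gens \<alpha>) \<and>
     b \<in> letters (B_gens \<beta>) \<and> b' \<in> letters (B_gens \<beta>)}"

text \<open>
  A simple graph is a pair of a vertex set and a set of two-element sets of vertices.
  The edges contributed by a geometric square do not depend on which of its representations
  as \<open>geometric_square a b a' b'\<close> is used, so ranging over all of them is harmless.
\<close>

definition Lk :: "nat \<Rightarrow> nat \<Rightarrow> gen letter list set set \<Rightarrow> gen letter set \<times> gen letter set set" where
  "Lk \<alpha> \<beta> S =
    (letters (A_gens \<alpha>) \<union> letters (B_gens \<beta>),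
     \<Union> {{{inv_letter a, b}, {a', inv_letter b}, {inv_letter a', b'}, {a, inv_letter b'}} | a b a' b'.
        a \<in> letters (A_gens \<alpha>) \<and> a' \<in> letters (A_gens \<alpha>) \<and>
        b \<in> letters (B_gens \<beta>) \<and> b' \<in> letters (B_gens \<beta>) \<and>
        geometric_square a b a' b' \<in> S})"

definition complete_bipartite :: "'v set \<Rightarrow> 'v set \<Rightarrow> 'v set \<times> 'v set set" where
  "complete_bipartite V W = (V \<union> W, {{v, w} | v w. v \<in> V \<and> w \<in> W})"

definition BM_relation :: "nat \<Rightarrow> nat \<Rightarrow> gen letter list set set \<Rightarrow> bool" where
  "BM_relation \<alpha> \<beta> R \<longleftrightarrow>
     0 < \<alpha> \<and> 0 < \<beta> \<and>
     R \<subseteq> GS \<alpha> \<beta> \<and> card R = \<alpha> * \<beta> \<and>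
     Lk \<alpha> \<beta> R = complete_bipartite (letters (A_gens \<alpha>)) (letters (B_gens \<beta>))"

text \<open>
  Every word in a geometric square \<open>[aba'b']\<close> is of the form \<open>aba'b'\<close> for some way of
  writing that square, so the relators given by \<open>R\<close> form the set \<open>\<Union>R\<close>.
\<close>

definition BM_group :: "nat \<Rightarrow> nat \<Rightarrow> 'g monoid \<Rightarrow> bool" where
  "BM_group \<alpha> \<beta> G \<longleftrightarrow>
     group G \<and>
     (\<exists>R. BM_relation \<alpha> \<beta> R \<and> G \<cong> presented_group (A_gens \<alpha> \<union> B_gens \<beta>) (\<Union>R))"

end

theory Submission
  imports Defs
begin

text \<open>
  The union of the squares of a \<open>(2,2)\<close>-BM relation consists of one word \<open>aba'b'\<close> for each of the 16
  corners \<open>(a, b)\<close>, so the relations can be enumerated by completing a partially filled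
  \<open>4 \<times> 4\<close> table square by square. The signed permutations of the two sets of letters act on the
  relations with 98 orbits. An explicit pair of mutually inverse word maps identifies the group of each orbit
  with one of 41 groups; that the maps respect relators and are inverse to each other is checked by moving
  \<open>B\<close>-letters to the right across \<open>A\<close>-letters. Finally, the 41 groups are told apart by their
  numbers of homomorphisms to \<open>\<int>/3\<close>, \<open>S\<^sub>3\<close>, the quaternion group, the dicyclic group of order 12
  and the affine group of the field with 5 elements.
\<close>

section \<open>Presented groups and their homomorphisms\<close>

text \<open>All finite work is evaluated by \<open>code_simp\<close>, that is, by rewriting inside
  the logic; this is why squares, tables and word maps are first-order data and why results of tests
  travel as arguments. Most computations act as certificates: the symmetries, word maps and normal
  forms only have to be sound, wherever they come from. Completeness is proved for the search alone,
  since it must reach every relation. The signed permutations keep the two alphabets apart;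
  interchanging the alphabets, or mixing them within one word, is left to the word maps, and this is
  how 98 orbits shrink to 41 groups. For non-isomorphism an invariant is required that can be
  computed from a presentation: homomorphisms to a finite group correspond to the quadruples of its
  elements that satisfy the four relators. The cheap targets come first, and the larger ones are
  used only where the earlier counts leave a tie.\<close>

lemma letters_iff: "l \<in> letters X \<longleftrightarrow> fst l \<in> X"
  by (cases l) (auto simp: letters_def)

lemma inv_letter_simps [simp]: "inv_letter (x, s) = (x, \<not> s)"
  by (simp add: inv_letter_def)

primrec lit_val :: "('g, 'm) monoid_scheme \<Rightarrow> ('x \<Rightarrow> 'g) \<Rightarrow> 'x letter \<Rightarrow> 'g" where
  "lit_val Q f (x, s) = (if s then f x else inv\<^bsub>Q\<^esub> f x)"

primrec word_val :: "('g, 'm) monoid_scheme \<Rightarrow> ('x \<Rightarrow> 'g) \<Rightarrow> 'x letter list \<Rightarrow> 'g" where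
  "word_val Q f [] = \<one>\<^bsub>Q\<^esub>"
| "word_val Q f (l # w) = lit_val Q f l \<otimes>\<^bsub>Q\<^esub> word_val Q f w"

context group
begin

lemma lit_val_closed: "f \<in> X \<rightarrow> carrier G \<Longrightarrow> l \<in> letters X \<Longrightarrow> lit_val G f l \<in> carrier G"
  by (cases l) (auto simp: letters_iff Pi_iff)

lemma lit_val_inv_letter:
  "f \<in> X \<rightarrow> carrier G \<Longrightarrow> l \<in> letters X \<Longrightarrow> lit_val G f (inv_letter l) = inv (lit_val G f l)"
  by (cases l) (auto simp: letters_iff Pi_iff)

lemma word_val_closed:
  "f \<in> X \<rightarrow> carrier G \<Longrightarrow> w \<in> lists (letters X) \<Longrightarrow> word_val G f w \<in> carrier G"
  by (induction w) (auto intro: lit_val_closed)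

lemma word_val_append:
  assumes "f \<in> X \<rightarrow> carrier G" "v \<in> lists (letters X)" "u \<in> lists (letters X)"
  shows "word_val G f (u @ v) = word_val G f u \<otimes> word_val G f v"
  using assms(3)
proof (induction u)
  case (Cons l u)
  then show ?case
    using assms(1,2) by (auto simp: m_assoc lit_val_closed word_val_closed simp del: in_lists_conv_set)
qed (use assms in \<open>auto simp: word_val_closed simp del: in_lists_conv_set\<close>)

lemma word_val_cong:
  "(\<And>x. x \<in> X \<Longrightarrow> f x = g x) \<Longrightarrow> w \<in> lists (letters X) \<Longrightarrow> word_val G f w = word_val G g w"
proof (induction w)
  case (Cons l w)
  then show ?case by (cases l) (auto simp: letters_iff)
qed simp

lemma word_val_inverse:
  assumes "f \<in> X \<rightarrow> carrier G" "w \<in> lists (letters X)"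
  shows "word_val G f (rev (map inv_letter w)) = inv (word_val G f w)"
  using assms(2)
proof (induction w)
  case (Cons l w)
  have "inv_letter l \<in> letters X" "rev (map inv_letter w) \<in> lists (letters X)"
    using Cons by (auto simp: letters_iff inv_letter_def)
  with Cons assms(1) show ?case
    by (simp add: word_val_append[OF assms(1)] lit_val_inv_letter[OF assms(1)] lit_val_closed[OF assms(1)]
        word_val_closed[OF assms(1)] inv_mult_group del: in_lists_conv_set)
qed simp

text \<open>Each elementary step inserts or deletes a factor whose value is one.\<close>

lemma word_val_pres_equiv:
  assumes f: "f \<in> X \<rightarrow> carrier G" and S: "\<And>r. r \<in> S \<Longrightarrow> r \<in> lists (letters X) \<Longrightarrow> word_val G f r = \<one>"
  shows "pres_equiv X S u v \<Longrightarrow> word_val G f u = word_val G f v"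
proof (induction rule: pres_equiv.induct)
  have insert: "word_val G f (u @ r @ v) = word_val G f (u @ v)"
    if "u \<in> lists (letters X)" "v \<in> lists (letters X)" "r \<in> lists (letters X)" "word_val G f r = \<one>" for u v r
  proof -
    have "r @ v \<in> lists (letters X)" using that by simp
    then show ?thesis using that f by (simp add: word_val_append[OF f] word_val_closed[OF f] del: in_lists_conv_set)
  qed
  {
    case (cancel u v l)
    then have "[l, inv_letter l] \<in> lists (letters X)" by (auto simp: letters_iff inv_letter_def)
    moreover have "word_val G f [l, inv_letter l] = \<one>"
      using cancel lit_val_inv_letter[OF f] lit_val_closed[OF f] by simp
    ultimately show ?case using insert cancel by blast
  next
    case (relator u v r)
    then show ?case using S insert by blast
  }
qed auto

end

definition pres_class :: "'x set \<Rightarrow> 'x letter list set \<Rightarrow> 'x letter list \<Rightarrow> 'x letter list set" where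
  "pres_class X S w = pres_rel X S `` {w}"

definition pres_gen :: "'x set \<Rightarrow> 'x letter list set \<Rightarrow> 'x \<Rightarrow> 'x letter list set" where
  "pres_gen X S x = pres_class X S [(x, True)]"

lemma carrier_presented_group: "carrier (presented_group X S) = pres_class X S ` lists (letters X)"
  by (auto simp: presented_group_def quotient_def pres_class_def)

lemma one_presented_group: "\<one>\<^bsub>presented_group X S\<^esub> = pres_class X S []"
  by (simp add: presented_group_def pres_class_def)

lemma pres_class_eq_iff:
  "u \<in> lists (letters X) \<Longrightarrow> v \<in> lists (letters X) \<Longrightarrow> pres_class X S u = pres_class X S v \<longleftrightarrow> pres_equiv X S u v"
  unfolding pres_class_def by (subst eq_equiv_class_iff[OF equiv_pres_rel]) (auto simp: pres_rel_def)

lemma pres_class_mult: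
  "u \<in> lists (letters X) \<Longrightarrow> v \<in> lists (letters X) \<Longrightarrow>
    pres_class X S u \<otimes>\<^bsub>presented_group X S\<^esub> pres_class X S v = pres_class X S (u @ v)"
  unfolding pres_class_def by (rule presented_group_mult)

lemma pres_gen_closed: "pres_gen X S \<in> X \<rightarrow> carrier (presented_group X S)"
  unfolding pres_gen_def carrier_presented_group by (auto simp: letters_iff intro!: imageI)

text \<open>Cancelling a trivial pair shows that the class of an inverse letter is the inverse of
  the generator. Hence \<open>pres_gen\<close> generates the group, and homomorphisms are determined
  by their values there.\<close>

lemma word_val_pres_gen:
  assumes "w \<in> lists (letters X)"
  shows "word_val (presented_group X S) (pres_gen X S) w = pres_class X S w"
  using assms
proof (induction w)
  case Nil
  then show ?case by (simp add: one_presented_group)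
next
  case (Cons l w)
  interpret P: group "presented_group X S" by (rule group_presented_group)
  obtain x s where l: "l = (x, s)" by fastforce
  have x: "x \<in> X" using Cons l by (auto simp: letters_iff)
  have words: "[(x, True)] \<in> lists (letters X)" "[(x, False)] \<in> lists (letters X)"
    using x by (auto simp: letters_iff)
  have "pres_equiv X S ([] @ [(x, False), inv_letter (x, False)] @ []) ([] @ [])"
    by (rule pres_equiv.cancel) (use x in \<open>auto simp: letters_iff\<close>)
  then have "pres_class X S [(x, False)] \<otimes>\<^bsub>presented_group X S\<^esub> pres_class X S [(x, True)] = \<one>\<^bsub>presented_group X S\<^esub>"
    using words pres_class_mult[OF words(2,1), of S] x
    by (simp add: one_presented_group pres_class_eq_iff letters_iff)
  then have "inv\<^bsub>presented_group X S\<^esub> (pres_class X S [(x, True)]) = pres_class X S [(x, False)]"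
    using words by (intro P.inv_equality) (auto simp: carrier_presented_group simp del: in_lists_conv_set)
  then have "lit_val (presented_group X S) (pres_gen X S) l = pres_class X S [l]"
    using l by (auto simp: pres_gen_def)
  moreover have "[l] \<in> lists (letters X)" "w \<in> lists (letters X)" using Cons by auto
  ultimately show ?case using Cons pres_class_mult[of "[l]" X w S] by (simp del: in_lists_conv_set)
qed

lemma word_val_pres_gen_relator:
  assumes "r \<in> S" "r \<in> lists (letters X)"
  shows "word_val (presented_group X S) (pres_gen X S) r = \<one>\<^bsub>presented_group X S\<^esub>"
proof -
  have "pres_equiv X S ([] @ r @ []) ([] @ [])" by (rule pres_equiv.relator) (use assms in auto)
  then show ?thesis using assms by (simp add: word_val_pres_gen one_presented_group pres_class_eq_iff)
qed

section \<open>The universal property of a presented group\<close>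

lemma hom_word_val:
  assumes "group G" "group H" "h \<in> hom G H" "f \<in> X \<rightarrow> carrier G" "w \<in> lists (letters X)"
  shows "h (word_val G f w) = word_val H (h \<circ> f) w"
  using assms(5)
proof (induction w)
  case Nil
  then show ?case using assms hom_one by fastforce
next
  case (Cons l w)
  interpret group_hom G H h using assms by (simp add: group_hom_def group_hom_axioms_def)
  have "h (lit_val G f l) = lit_val H (h \<circ> f) l"
    using Cons assms(4) by (cases l) (auto simp: letters_iff Pi_iff)
  then show ?case
    using Cons assms(4) by (simp add: G.lit_val_closed[OF assms(4)] G.word_val_closed[OF assms(4)] o_def del: in_lists_conv_set)
qed

text \<open>Evaluation on an arbitrary representative; well defined when \<open>f\<close> kills the relators.\<close>

definition pres_lift ::
    "'x set \<Rightarrow> 'x letter list set \<Rightarrow> ('g, 'm) monoid_scheme \<Rightarrow> ('x \<Rightarrow> 'g) \<Rightarrow> 'x letter list set \<Rightarrow> 'g" where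
  "pres_lift X S Q f =
    (\<lambda>U\<in>carrier (presented_group X S). word_val Q f (SOME u. u \<in> lists (letters X) \<and> U = pres_class X S u))"

definition relator_maps :: "'x set \<Rightarrow> 'x letter list set \<Rightarrow> ('g, 'm) monoid_scheme \<Rightarrow> ('x \<Rightarrow> 'g) set" where
  "relator_maps X S Q = {f \<in> X \<rightarrow>\<^sub>E carrier Q. \<forall>r\<in>S. word_val Q f r = \<one>\<^bsub>Q\<^esub>}"

lemma pres_lift_class:
  assumes Q: "group Q" and f: "f \<in> X \<rightarrow> carrier Q" "\<forall>r\<in>S. word_val Q f r = \<one>\<^bsub>Q\<^esub>" and w: "w \<in> lists (letters X)"
  shows "pres_lift X S Q f (pres_class X S w) = word_val Q f w"
proof -
  let ?u = "SOME u. u \<in> lists (letters X) \<and> pres_class X S w = pres_class X S u"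
  have u: "?u \<in> lists (letters X) \<and> pres_class X S w = pres_class X S ?u"
    by (rule someI[of _ w]) (use w in auto)
  then have "pres_equiv X S w ?u" using w pres_class_eq_iff by blast
  then have "word_val Q f ?u = word_val Q f w"
    using group.word_val_pres_equiv[OF Q f(1)] f(2) by metis
  then show ?thesis using w by (auto simp: pres_lift_def carrier_presented_group simp del: in_lists_conv_set)
qed

lemma pres_lift_hom:
  assumes Q: "group Q" and f: "f \<in> X \<rightarrow> carrier Q" "\<forall>r\<in>S. word_val Q f r = \<one>\<^bsub>Q\<^esub>"
  shows "pres_lift X S Q f \<in> hom (presented_group X S) Q"
proof (rule homI)
  interpret group Q by fact
  note lift = pres_lift_class[OF Q f]
  fix U V assume "U \<in> carrier (presented_group X S)" "V \<in> carrier (presented_group X S)"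
  then obtain u v where uv: "u \<in> lists (letters X)" "v \<in> lists (letters X)" "U = pres_class X S u" "V = pres_class X S v"
    by (auto simp: carrier_presented_group simp del: in_lists_conv_set)
  then have "u @ v \<in> lists (letters X)" by auto
  then show "pres_lift X S Q f (U \<otimes>\<^bsub>presented_group X S\<^esub> V) = pres_lift X S Q f U \<otimes>\<^bsub>Q\<^esub> pres_lift X S Q f V"
    using uv lift word_val_append[OF f(1)] by (simp add: pres_class_mult del: in_lists_conv_set)
  show "pres_lift X S Q f U \<in> carrier Q" using uv lift word_val_closed[OF f(1)] by simp
qed

lemma pres_lift_gen:
  assumes Q: "group Q" and f: "f \<in> X \<rightarrow> carrier Q" "\<forall>r\<in>S. word_val Q f r = \<one>\<^bsub>Q\<^esub>" and x: "x \<in> X"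
  shows "pres_lift X S Q f (pres_gen X S x) = f x"
proof -
  interpret group Q by fact
  have "[(x, True)] \<in> lists (letters X)" using x by (simp add: letters_iff)
  then show ?thesis
    using pres_lift_class[OF Q f, of "[(x, True)]"] f(1) x by (auto simp: pres_gen_def Pi_iff)
qed

text \<open>\<open>hom\<close> leaves values outside the carrier arbitrary, which would make the set
  infinite and its \<open>card\<close> zero; extensionality makes counting meaningful.\<close>

definition hom_ext :: "('a, 'm) monoid_scheme \<Rightarrow> ('b, 'n) monoid_scheme \<Rightarrow> ('a \<Rightarrow> 'b) set" where
  "hom_ext G H = hom G H \<inter> extensional (carrier G)"

lemma hom_presented_group_eqI:
  assumes Q: "group Q" and h: "h \<in> hom (presented_group X S) Q" and k: "k \<in> hom (presented_group X S) Q"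
    and eq: "\<And>x. x \<in> X \<Longrightarrow> h (pres_gen X S x) = k (pres_gen X S x)" and U: "U \<in> carrier (presented_group X S)"
  shows "h U = k U"
proof -
  obtain w where w: "w \<in> lists (letters X)" "U = word_val (presented_group X S) (pres_gen X S) w"
    using U word_val_pres_gen by (fastforce simp: carrier_presented_group simp del: in_lists_conv_set)
  have "word_val Q (h \<circ> pres_gen X S) w = word_val Q (k \<circ> pres_gen X S) w"
    by (rule group.word_val_cong[OF Q _ w(1)]) (simp add: eq)
  then show ?thesis
    using w hom_word_val[OF group_presented_group Q _ pres_gen_closed] h k by metis
qed

text \<open>Restriction to the generators and \<open>pres_lift\<close> are mutually inverse.\<close>

lemma card_hom_ext_presented_group:
  fixes Q :: "('g, 'm) monoid_scheme" and X :: "'x set"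
  assumes Q: "group Q" and S: "S \<subseteq> lists (letters X)"
  shows "card (hom_ext (presented_group X S) Q) = card (relator_maps X S Q)"
proof (rule bij_betw_same_card[OF bij_betw_byWitness])
  let ?P = "presented_group X S"
  interpret P: group ?P by (rule group_presented_group)
  define res :: "('x letter list set \<Rightarrow> 'g) \<Rightarrow> 'x \<Rightarrow> 'g" where "res = (\<lambda>h. \<lambda>x\<in>X. h (pres_gen X S x))"
  have relD: "f \<in> X \<rightarrow> carrier Q" "\<forall>r\<in>S. word_val Q f r = \<one>\<^bsub>Q\<^esub>" if "f \<in> relator_maps X S Q" for f
    using that by (auto simp: relator_maps_def)
  have res_mem: "res h \<in> relator_maps X S Q" if h: "h \<in> hom_ext ?P Q" for h
  proof -
    have hom: "h \<in> hom ?P Q" using h by (simp add: hom_ext_def)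
    have "word_val Q (res h) r = \<one>\<^bsub>Q\<^esub>" if r: "r \<in> S" for r
    proof -
      have "word_val Q (res h) r = word_val Q (h \<circ> pres_gen X S) r"
        by (rule group.word_val_cong[OF Q, of X]) (use S r in \<open>auto simp: res_def\<close>)
      also have "\<dots> = h (word_val ?P (pres_gen X S) r)"
        by (rule hom_word_val[OF P.group_axioms Q hom pres_gen_closed, symmetric]) (use S r in blast)
      also have "\<dots> = h \<one>\<^bsub>?P\<^esub>" using word_val_pres_gen_relator r S by fastforce
      also have "\<dots> = \<one>\<^bsub>Q\<^esub>" using hom_one[OF hom P.group_axioms Q] .
      finally show ?thesis .
    qed
    moreover have "res h \<in> X \<rightarrow>\<^sub>E carrier Q"
      using hom pres_gen_closed[of X S] by (auto simp: res_def hom_def Pi_iff)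
    ultimately show ?thesis by (simp add: relator_maps_def)
  qed
  show "res ` hom_ext ?P Q \<subseteq> relator_maps X S Q" using res_mem by auto
  show "pres_lift X S Q ` relator_maps X S Q \<subseteq> hom_ext ?P Q"
    using pres_lift_hom[OF Q relD] by (auto simp: hom_ext_def pres_lift_def)
  show "\<forall>f\<in>relator_maps X S Q. res (pres_lift X S Q f) = f"
  proof
    fix f assume f: "f \<in> relator_maps X S Q"
    then have "f \<in> extensional X" by (auto simp: relator_maps_def PiE_def)
    then show "res (pres_lift X S Q f) = f"
      using pres_lift_gen[OF Q relD[OF f]] by (auto simp: res_def extensional_def fun_eq_iff)
  qed
  show "\<forall>h\<in>hom_ext ?P Q. pres_lift X S Q (res h) = h"
  proof
    fix h assume h: "h \<in> hom_ext ?P Q"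
    note rel = relD[OF res_mem[OF h]]
    show "pres_lift X S Q (res h) = h"
    proof (rule extensionalityI[of _ "carrier ?P"])
      show "pres_lift X S Q (res h) U = h U" if "U \<in> carrier ?P" for U
        by (rule hom_presented_group_eqI[OF Q pres_lift_hom[OF Q rel] _ _ that])
          (use h pres_lift_gen[OF Q rel] in \<open>auto simp: res_def hom_ext_def\<close>)
    qed (use h in \<open>auto simp: hom_ext_def pres_lift_def\<close>)
  qed
qed

text \<open>Composing with an isomorphism and composing with its inverse undo each other;
  \<open>compose\<close> keeps the results extensional.\<close>

lemma card_hom_ext_iso:
  assumes GH: "G \<cong> H" and G: "group G" and H: "group H"
  shows "card (hom_ext G Q) = card (hom_ext H Q)"
proof -
  obtain \<phi> where \<phi>: "\<phi> \<in> iso G H" using GH by (auto simp: is_iso_def)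
  define \<psi> where "\<psi> = inv_into (carrier G) \<phi>"
  have \<psi>: "\<psi> \<in> iso H G" unfolding \<psi>_def by (rule group.iso_set_sym[OF G \<phi>])
  have bij: "bij_betw \<phi> (carrier G) (carrier H)" using \<phi> by (auto simp: iso_def)
  have inv: "\<psi> (\<phi> x) = x" if "x \<in> carrier G" for x
    using bij that unfolding \<psi>_def by (simp add: bij_betw_def)
  have inv': "\<phi> (\<psi> y) = y" if "y \<in> carrier H" for y
    using bij that unfolding \<psi>_def by (simp add: bij_betw_def f_inv_into_f)
  have \<phi>c: "\<phi> x \<in> carrier H" if "x \<in> carrier G" for x using \<phi> that by (auto simp: iso_def hom_def)
  have \<psi>c: "\<psi> y \<in> carrier G" if "y \<in> carrier H" for y using \<psi> that by (auto simp: iso_def hom_def)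
  have \<phi>m: "\<phi> (x \<otimes>\<^bsub>G\<^esub> y) = \<phi> x \<otimes>\<^bsub>H\<^esub> \<phi> y" if "x \<in> carrier G" "y \<in> carrier G" for x y
    using \<phi> that by (auto simp: iso_def hom_def)
  have \<psi>m: "\<psi> (x \<otimes>\<^bsub>H\<^esub> y) = \<psi> x \<otimes>\<^bsub>G\<^esub> \<psi> y" if "x \<in> carrier H" "y \<in> carrier H" for x y
    using \<psi> that by (auto simp: iso_def hom_def)
  interpret G: group G by fact
  interpret H: group H by fact
  show ?thesis
  proof (rule bij_betw_same_card[OF bij_betw_byWitness])
    let ?F = "\<lambda>h. compose (carrier H) h \<psi>" and ?K = "\<lambda>h. compose (carrier G) h \<phi>"
    show "\<forall>h\<in>hom_ext G Q. ?K (?F h) = h"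
      using \<phi>c inv by (auto simp: hom_ext_def compose_def extensional_def fun_eq_iff)
    show "\<forall>h\<in>hom_ext H Q. ?F (?K h) = h"
      using \<psi>c inv' by (auto simp: hom_ext_def compose_def extensional_def fun_eq_iff)
    show "?F ` hom_ext G Q \<subseteq> hom_ext H Q"
      using \<psi>c \<psi>m by (auto simp: hom_ext_def compose_def hom_def Pi_iff)
    show "?K ` hom_ext H Q \<subseteq> hom_ext G Q"
      using \<phi>c \<phi>m by (auto simp: hom_ext_def compose_def hom_def Pi_iff)
  qed
qed

text \<open>The two lifts compose to homomorphisms that fix all generators, hence to
  identities.\<close>

lemma presented_group_isoI:
  fixes X :: "'x set" and Y :: "'y set" and S :: "'x letter list set" and T :: "'y letter list set"
  defines "P \<equiv> presented_group X S" and "Q \<equiv> presented_group Y T"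
  assumes f: "f \<in> X \<rightarrow> carrier Q" "\<forall>r\<in>S. word_val Q f r = \<one>\<^bsub>Q\<^esub>"
    and g: "g \<in> Y \<rightarrow> carrier P" "\<forall>r\<in>T. word_val P g r = \<one>\<^bsub>P\<^esub>"
    and gf: "\<And>x. x \<in> X \<Longrightarrow> pres_lift Y T P g (f x) = pres_gen X S x"
    and fg: "\<And>y. y \<in> Y \<Longrightarrow> pres_lift X S Q f (g y) = pres_gen Y T y"
  shows "P \<cong> Q"
proof -
  let ?f = "pres_lift X S Q f" and ?g = "pres_lift Y T P g"
  interpret P: group P unfolding P_def by (rule group_presented_group)
  interpret Q: group Q unfolding Q_def by (rule group_presented_group)
  have F: "?f \<in> hom P Q" unfolding P_def by (rule pres_lift_hom[OF Q.group_axioms f])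
  have K: "?g \<in> hom Q P" unfolding Q_def by (rule pres_lift_hom[OF P.group_axioms g])
  have "(?g \<circ> ?f) U = id U" if "U \<in> carrier P" for U
  proof (rule hom_presented_group_eqI[where h = "?g \<circ> ?f" and k = id and Q = P and X = X and S = S and U = U, folded P_def])
    show "?g \<circ> ?f \<in> hom P P" using F K by (rule Group.hom_compose)
    show "(?g \<circ> ?f) (pres_gen X S x) = id (pres_gen X S x)" if "x \<in> X" for x
      using pres_lift_gen[OF Q.group_axioms f that] gf[OF that] by simp
  qed (use that P.group_axioms in \<open>auto simp: hom_def\<close>)
  moreover have "(?f \<circ> ?g) U = id U" if "U \<in> carrier Q" for U
  proof (rule hom_presented_group_eqI[where h = "?f \<circ> ?g" and k = id and Q = Q and X = Y and S = T and U = U, folded Q_def])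
    show "?f \<circ> ?g \<in> hom Q Q" using K F by (rule Group.hom_compose)
    show "(?f \<circ> ?g) (pres_gen Y T x) = id (pres_gen Y T x)" if "x \<in> Y" for x
      using pres_lift_gen[OF P.group_axioms g that] fg[OF that] by simp
  qed (use that Q.group_axioms in \<open>auto simp: hom_def\<close>)
  ultimately have "bij_betw ?f (carrier P) (carrier Q)"
    using F K by (intro bij_betw_byWitness[of _ ?g]) (auto simp: hom_def)
  then have "?f \<in> iso P Q" using F by (simp add: iso_def)
  then show ?thesis by (auto simp: is_iso_def)
qed

section \<open>BM relations as sets of coded squares\<close>

text \<open>Sign (\<open>P\<close> or \<open>N\<close>) and index of a letter. Both alphabets share
  these codes, because the position within a square already tells \<open>A\<close> from
  \<open>B\<close>.\<close>

datatype code = P1 | N1 | P2 | N2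

fun bar :: "code \<Rightarrow> code" where
  "bar P1 = N1" | "bar N1 = P1" | "bar P2 = N2" | "bar N2 = P2"

datatype clet = A code | B code

fun cbar :: "clet \<Rightarrow> clet" where
  "cbar (A c) = A (bar c)" | "cbar (B c) = B (bar c)"

fun to_letter :: "clet \<Rightarrow> gen letter" where
  "to_letter (A P1) = (GenA 1, True)" | "to_letter (A N1) = (GenA 1, False)"
| "to_letter (A P2) = (GenA 2, True)" | "to_letter (A N2) = (GenA 2, False)"
| "to_letter (B P1) = (GenB 1, True)" | "to_letter (B N1) = (GenB 1, False)"
| "to_letter (B P2) = (GenB 2, True)" | "to_letter (B N2) = (GenB 2, False)"

type_synonym square = "code \<times> code \<times> code \<times> code"

fun square_word :: "square \<Rightarrow> clet list" where
  "square_word (a, b, c, d) = [A a, B b, A c, B d]"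

definition word :: "square \<Rightarrow> gen letter list" where
  "word s = map to_letter (square_word s)"

fun variants :: "square \<Rightarrow> square list" where
  "variants (a, b, c, d) =
    [(a, b, c, d), (c, d, a, b), (bar a, bar d, bar c, bar b), (bar c, bar b, bar a, bar d)]"

definition gens :: "gen set" where "gens = A_gens 2 \<union> B_gens 2"

definition square_group :: "square set \<Rightarrow> gen letter list set monoid" where
  "square_group V = presented_group gens (word ` V)"

definition all_variants :: "square list \<Rightarrow> square list" where
  "all_variants ws = concat (map variants ws)"

lemma bar_bar [simp]: "bar (bar c) = c" by (cases c) auto
lemma bar_eq_iff [simp]: "bar c = bar d \<longleftrightarrow> c = d" by (metis bar_bar)
lemma bar_neq [simp]: "bar c \<noteq> c" "c \<noteq> bar c" by (cases c; simp)+
lemma cbar_cbar [simp]: "cbar (cbar l) = l" by (cases l) auto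

lemma UNIV_code: "UNIV = {P1, N1, P2, N2}"
proof -
  have "c \<in> {P1, N1, P2, N2}" for c by (cases c) auto
  then show ?thesis by blast
qed

instance code :: finite by standard (simp add: UNIV_code)

lemma card_code: "card (UNIV :: code set) = 4" by (simp add: UNIV_code)

lemma inj_to_letter: "inj to_letter"
proof (rule injI)
  fix x y show "to_letter x = to_letter y \<Longrightarrow> x = y"
    by (cases x rule: to_letter.cases; cases y rule: to_letter.cases) auto
qed

lemma to_letter_eq_iff [simp]: "to_letter x = to_letter y \<longleftrightarrow> x = y" using inj_to_letter by (auto dest: injD)

lemma inv_letter_to_letter: "inv_letter (to_letter l) = to_letter (cbar l)"
  by (cases l rule: to_letter.cases) (auto simp: inv_letter_def)

lemma atLeastAtMost_1_2: "{1..2} = {1, 2 :: nat}" by auto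

lemma letters_A: "letters (A_gens 2) = range (\<lambda>c. to_letter (A c))"
  by (auto simp: letters_def A_gens_def atLeastAtMost_1_2 UNIV_code UNIV_bool)

lemma letters_B: "letters (B_gens 2) = range (\<lambda>c. to_letter (B c))"
  by (auto simp: letters_def B_gens_def atLeastAtMost_1_2 UNIV_code UNIV_bool)

lemma letters_gens: "letters gens = range to_letter"
proof -
  have "letters gens = letters (A_gens 2) \<union> letters (B_gens 2)" by (auto simp: letters_def gens_def)
  also have "\<dots> = range to_letter" unfolding letters_A letters_B by (auto, metis clet.exhaust rangeI)
  finally show ?thesis .
qed

lemma map_to_letter_lists [simp]: "map to_letter w \<in> lists (letters gens)"
  by (auto simp: letters_gens)

lemma word_lists: "word ` V \<subseteq> lists (letters gens)"
  by (auto simp: word_def letters_gens)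

lemma inj_word: "inj word"
  by (rule injI) (auto simp: word_def)

lemma geometric_square_to_letter:
  "geometric_square (to_letter (A a)) (to_letter (B b)) (to_letter (A c)) (to_letter (B d)) = word ` set (variants (a, b, c, d))"
  by (auto simp: geometric_square_def word_def inv_letter_to_letter)

lemma variants_self: "s \<in> set (variants s)" by (cases s) auto

text \<open>The four variants are an orbit of a Klein four-group, generated by the half-turn and a
  reflection, so any member yields the same set.\<close>

lemma set_variants_eq: "t \<in> set (variants s) \<Longrightarrow> set (variants t) = set (variants s)"
  by (cases s, simp, elim disjE) (simp_all add: insert_commute)

lemma card_variants_le: "card (word ` set (variants s)) \<le> 4"
proof -
  have "card (word ` set (variants s)) \<le> card (set (variants s))" by (simp add: card_image_le)
  also have "\<dots> \<le> length (variants s)" by (rule card_length)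
  also have "\<dots> = 4" by (cases s) simp
  finally show ?thesis .
qed

text \<open>
  The union of the squares of a BM relation: one square at each of the 16 corners \<open>(a, b)\<close>,
  and none of the form \<open>[abab]\<close>.
\<close>

definition valid :: "square set \<Rightarrow> bool" where
  "valid V \<longleftrightarrow>
     (\<forall>s\<in>V. set (variants s) \<subseteq> V) \<and>
     (\<forall>a b c d c' d'. (a, b, c, d) \<in> V \<longrightarrow> (a, b, c', d') \<in> V \<longrightarrow> c = c' \<and> d = d') \<and>
     (\<forall>a b. \<exists>c d. (a, b, c, d) \<in> V) \<and>
     (\<forall>a b. (a, b, a, b) \<notin> V)"

definition corner :: "square \<Rightarrow> code \<times> code" where
  "corner s = (fst s, fst (snd s))"

lemma GS_2_2: "GS 2 2 = range (\<lambda>s. word ` set (variants s))"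
proof (intro equalityI subsetI)
  fix S assume "S \<in> GS 2 2"
  then obtain a b c d where "S = geometric_square (to_letter (A a)) (to_letter (B b)) (to_letter (A c)) (to_letter (B d))"
    unfolding GS_def letters_A letters_B by blast
  then show "S \<in> range (\<lambda>s. word ` set (variants s))"
    unfolding geometric_square_to_letter by blast
next
  fix S assume "S \<in> range (\<lambda>s. word ` set (variants s))"
  then obtain a b c d where "S = word ` set (variants (a, b, c, d))" by (auto simp del: variants.simps)
  then show "S \<in> GS 2 2"
    unfolding GS_def letters_A letters_B geometric_square_to_letter[symmetric] by blast
qed

lemma setcompr_range:
  "{F a b a' b' | a b a' b'. a \<in> range f \<and> a' \<in> range f \<and> b \<in> range g \<and> b' \<in> range g \<and> P a b a' b'} =
    {F (f x) (g y) (f z) (g w) | x y z w. P (f x) (g y) (f z) (g w)}"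
  by blast

lemma edges_Lk:
  "snd (Lk 2 2 R) = \<Union> {{{to_letter (A (bar x)), to_letter (B y)}, {to_letter (A z), to_letter (B (bar y))}, {to_letter (A (bar z)), to_letter (B w)},
      {to_letter (A x), to_letter (B (bar w))}} | x y z w. word ` set (variants (x, y, z, w)) \<in> R}"
  unfolding Lk_def letters_A letters_B snd_conv setcompr_range geometric_square_to_letter inv_letter_to_letter cbar.simps ..

text \<open>The four edges of a square are read off from the first two letters of its four words,
  with the first letter inverted; this is the origin of \<open>bar a\<close>.\<close>

lemma edge_Lk_iff: "{to_letter (A a), to_letter (B b)} \<in> snd (Lk 2 2 R) \<longleftrightarrow> (\<exists>c d. word ` set (variants (bar a, b, c, d)) \<in> R)"
proof
  assume "{to_letter (A a), to_letter (B b)} \<in> snd (Lk 2 2 R)"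
  then obtain x y z w where sq: "word ` set (variants (x, y, z, w)) \<in> R"
    and "{to_letter (A a), to_letter (B b)} \<in> {{to_letter (A (bar x)), to_letter (B y)}, {to_letter (A z), to_letter (B (bar y))},
        {to_letter (A (bar z)), to_letter (B w)}, {to_letter (A x), to_letter (B (bar w))}}"
    unfolding edges_Lk by blast
  then have "a = bar x \<and> b = y \<or> a = z \<and> b = bar y \<or> a = bar z \<and> b = w \<or> a = x \<and> b = bar w"
    by (auto simp: doubleton_eq_iff)
  then have "\<exists>c d. (bar a, b, c, d) \<in> set (variants (x, y, z, w))" by (elim disjE) force+
  then obtain c d where "(bar a, b, c, d) \<in> set (variants (x, y, z, w))" by blast
  then have "set (variants (bar a, b, c, d)) = set (variants (x, y, z, w))" by (rule set_variants_eq)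
  then show "\<exists>c d. word ` set (variants (bar a, b, c, d)) \<in> R"
    using sq by metis
next
  assume "\<exists>c d. word ` set (variants (bar a, b, c, d)) \<in> R"
  then obtain c d where "word ` set (variants (bar a, b, c, d)) \<in> R" by blast
  moreover have "{to_letter (A a), to_letter (B b)} = {to_letter (A (bar (bar a))), to_letter (B b)}" by simp
  ultimately show "{to_letter (A a), to_letter (B b)} \<in> snd (Lk 2 2 R)"
    unfolding edges_Lk by blast
qed

text \<open>Link edges always join the two alphabets, so only the presence of every such edge is at
  stake; \<open>bar\<close> disappears because it is a bijection.\<close>

lemma complete_bipartite_iff:
  "Lk 2 2 R = complete_bipartite (letters (A_gens 2)) (letters (B_gens 2)) \<longleftrightarrow>
    (\<forall>a b. \<exists>c d. word ` set (variants (a, b, c, d)) \<in> R)"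
proof -
  have le: "snd (Lk 2 2 R) \<subseteq> {{to_letter (A a), to_letter (B b)} | a b. True}"
    unfolding edges_Lk by blast
  have "{{v, w} | v w. v \<in> letters (A_gens 2) \<and> w \<in> letters (B_gens 2)} = {{to_letter (A a), to_letter (B b)} | a b. True}"
    unfolding letters_A letters_B by blast
  moreover have "fst (Lk 2 2 R) = letters (A_gens 2) \<union> letters (B_gens 2)" by (simp add: Lk_def)
  ultimately have "Lk 2 2 R = complete_bipartite (letters (A_gens 2)) (letters (B_gens 2)) \<longleftrightarrow>
      snd (Lk 2 2 R) = {{to_letter (A a), to_letter (B b)} | a b. True}"
    by (simp add: complete_bipartite_def prod_eq_iff)
  also have "\<dots> \<longleftrightarrow> (\<forall>a b. {to_letter (A a), to_letter (B b)} \<in> snd (Lk 2 2 R))" using le by blast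
  also have "\<dots> \<longleftrightarrow> (\<forall>a b. \<exists>c d. word ` set (variants (bar a, b, c, d)) \<in> R)"
    unfolding edge_Lk_iff ..
  also have "\<dots> \<longleftrightarrow> (\<forall>a b. \<exists>c d. word ` set (variants (a, b, c, d)) \<in> R)"
    by (metis bar_bar)
  finally show ?thesis .
qed

lemma card_Union_squares_le:
  assumes "R \<subseteq> GS 2 2" "finite R"
  shows "card (\<Union>R) \<le> 4 * card R"
proof -
  have "card S \<le> 4" if "S \<in> R" for S using assms that card_variants_le unfolding GS_2_2 by blast
  then show ?thesis
    using card_Union_le_sum_card[of R] sum_bounded_above[of R card 4] by (simp add: mult.commute)
qed

text \<open>A counting argument: four squares have at most 16 words, while the link condition asks
  for a word at each of the 16 corners. So nothing can be wasted, neither by two words at one corner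
  nor by a square with fewer than four words.\<close>

lemma BM_relation_valid:
  assumes "BM_relation 2 2 R"
  obtains V where "\<Union>R = word ` V" "valid V"
proof
  have R: "R \<subseteq> GS 2 2" and card_R: "card R = 4"
    and total: "\<exists>c d. word ` set (variants (a, b, c, d)) \<in> R" for a b
    using assms complete_bipartite_iff by (auto simp: BM_relation_def)
  have fin: "finite R" using card_R card_ge_0_finite by force
  define V where "V = {s. word s \<in> \<Union>R}"
  have closed: "set (variants s) \<subseteq> V" "word ` set (variants s) \<in> R" if s: "s \<in> V" for s
  proof -
    obtain S where S: "S \<in> R" "word s \<in> S" using s unfolding V_def by blast
    then obtain t where "S = word ` set (variants t)" using R unfolding GS_2_2 by blast
    with S have t: "word ` set (variants t) \<in> R" "word s \<in> word ` set (variants t)" by simp_all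
    from t(2) have "s \<in> set (variants t)" using inj_word by (simp add: inj_image_mem_iff)
    then show "set (variants s) \<subseteq> V" "word ` set (variants s) \<in> R"
      using t(1) by (auto simp: V_def set_variants_eq[of s t] simp del: variants.simps)
  qed
  have "x \<in> range word" if "x \<in> \<Union>R" for x using that R unfolding GS_2_2 by blast
  then show UN: "\<Union>R = word ` V" unfolding V_def by blast
  have V_total: "\<exists>c d. (a, b, c, d) \<in> V" for a b
    using total[of a b] variants_self unfolding V_def by blast
  have card_V: "card V = card (\<Union>R)" unfolding UN by (simp add: card_image inj_on_subset[OF inj_word])
  have finV: "finite V" by simp
  have surj: "corner ` V = UNIV" using V_total by (force simp: corner_def)
  have card_corner: "card (UNIV :: (code \<times> code) set) = 16"
    by (simp add: card_code card_cartesian_product flip: UNIV_Times_UNIV)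
  have ge: "16 \<le> card V" using card_image_le[OF finV, of corner] surj card_corner by simp
  have "card V \<le> 16" using card_Union_squares_le[OF R fin] card_R card_V by simp
  then have inj: "inj_on corner V" using ge surj card_corner finV by (intro eq_card_imp_inj_on) auto
  have nondeg: "(a, b, a, b) \<notin> V" for a b
  proof
    assume ab: "(a, b, a, b) \<in> V"
    let ?S = "word ` set (variants (a, b, a, b))"
    have S: "?S \<in> R" using closed(2)[OF ab] .
    \<comment> \<open>The half-turn fixes \<open>(a, b, a, b)\<close>, so this square has at most
      two words; with at most 12 from the other three squares, the total stays below 16.\<close>
    have "card (set (variants (a, b, a, b))) \<le> 2" by (simp add: card_insert_if)
    then have "card ?S \<le> 2" using card_image_le[of "set (variants (a, b, a, b))" word, OF List.finite_set] by linarith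
    moreover have "card (\<Union>(R - {?S})) \<le> 12"
      using card_Union_squares_le[of "R - {?S}"] R fin S card_R by (simp add: subset_iff)
    moreover have "\<Union>R = ?S \<union> \<Union>(R - {?S})" using S by blast
    then have "card (\<Union>R) \<le> card ?S + card (\<Union>(R - {?S}))" by (metis card_Un_le)
    ultimately show False using ge card_V by linarith
  qed
  show "valid V"
    unfolding valid_def
  proof (intro conjI allI impI)
    fix a b c d c' d' assume "(a, b, c, d) \<in> V" "(a, b, c', d') \<in> V"
    then have "(a, b, c, d) = (a, b, c', d')" using inj_onD[OF inj, of "(a, b, c, d)" "(a, b, c', d')"] by (simp add: corner_def)
    then show "c = c'" "d = d'" by simp_all
  qed (use closed(1) V_total nondeg in blast)+
qed

text \<open>The converse count: covering 16 corners takes at least four squares, so the four listed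
  squares are distinct.\<close>

lemma BM_relation_squares:
  assumes len: "length ws = 4" and total: "\<And>a b. \<exists>c d. (a, b, c, d) \<in> set (all_variants ws)"
  obtains R where "BM_relation 2 2 R" "\<Union>R = word ` set (all_variants ws)"
proof
  define R where "R = (\<lambda>s. word ` set (variants s)) ` set ws"
  have R: "R \<subseteq> GS 2 2" unfolding R_def GS_2_2 by blast
  show UN: "\<Union>R = word ` set (all_variants ws)" unfolding R_def all_variants_def by auto
  have "card R \<le> 4" unfolding R_def
    using card_image_le[of "set ws" "\<lambda>s. word ` set (variants s)"] card_length[of ws] len by simp
  moreover have "corner ` set (all_variants ws) = UNIV" using total by (force simp: corner_def)
  then have "16 \<le> card (set (all_variants ws))"
    using card_image_le[of "set (all_variants ws)" corner]
    by (simp add: card_code card_cartesian_product flip: UNIV_Times_UNIV)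
  then have "16 \<le> card (\<Union>R)" unfolding UN by (simp add: card_image inj_on_subset[OF inj_word])
  then have "4 \<le> card R" using card_Union_squares_le[OF R] by (simp add: R_def)
  moreover have "\<exists>c d. word ` set (variants (a, b, c, d)) \<in> R" for a b
  proof -
    obtain c d s where "(a, b, c, d) \<in> set (variants s)" "s \<in> set ws"
      using total[of a b] by (auto simp: all_variants_def)
    then show ?thesis using set_variants_eq unfolding R_def by blast
  qed
  ultimately show "BM_relation 2 2 R"
    using R complete_bipartite_iff by (simp add: BM_relation_def)
qed

section \<open>Tables of squares\<close>

text \<open>An array indexed by \<open>code\<close>. Unlike an updated function it has a normal form
  that pattern matching can read directly.\<close>

datatype 'a quad = Quad 'a 'a 'a 'a

fun get :: "'a quad \<Rightarrow> code \<Rightarrow> 'a" where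
  "get (Quad x y z w) P1 = x" | "get (Quad x y z w) N1 = y"
| "get (Quad x y z w) P2 = z" | "get (Quad x y z w) N2 = w"

fun put :: "'a quad \<Rightarrow> code \<Rightarrow> 'a \<Rightarrow> 'a quad" where
  "put (Quad x y z w) P1 v = Quad v y z w" | "put (Quad x y z w) N1 v = Quad x v z w"
| "put (Quad x y z w) P2 v = Quad x y v w" | "put (Quad x y z w) N2 v = Quad x y z v"

type_synonym table = "(code \<times> code) option quad quad"

definition cell :: "table \<Rightarrow> code \<Rightarrow> code \<Rightarrow> (code \<times> code) option" where
  "cell T a b = get (get T a) b"

definition entries :: "table \<Rightarrow> square set" where
  "entries T = {(a, b, c, d). cell T a b = Some (c, d)}"

definition put_cell :: "table \<Rightarrow> code \<Rightarrow> code \<Rightarrow> code \<Rightarrow> code \<Rightarrow> table" where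
  "put_cell T a b c d = put T a (put (get T a) b (Some (c, d)))"

definition put_square :: "table \<Rightarrow> code \<Rightarrow> code \<Rightarrow> code \<Rightarrow> code \<Rightarrow> table" where
  "put_square T a b c d =
    put_cell (put_cell (put_cell (put_cell T a b c d) c d a b) (bar a) (bar d) (bar c) (bar b)) (bar c) (bar b) (bar a) (bar d)"

definition empty_table :: table where
  "empty_table = (let r = Quad None None None None in Quad r r r r)"

fun put_squares :: "table \<Rightarrow> square list \<Rightarrow> table" where
  "put_squares T [] = T"
| "put_squares T ((a, b, c, d) # ws) = put_squares (put_square T a b c d) ws"

definition table_of :: "square list \<Rightarrow> table" where
  "table_of ws = put_squares empty_table ws"

lemma get_put: "get (put q a v) b = (if a = b then v else get q b)"
  by (cases q; cases a; cases b) auto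

lemma cell_put_cell: "cell (put_cell T a b c d) x y = (if x = a \<and> y = b then Some (c, d) else cell T x y)"
  by (auto simp: cell_def put_cell_def get_put)

text \<open>Only an inclusion, since the new entry may overwrite an old one at the same
  corner.\<close>

lemma entries_put_cell: "entries (put_cell T a b c d) \<subseteq> insert (a, b, c, d) (entries T)"
  by (auto simp: entries_def cell_put_cell split: if_splits)

lemma entries_put_square: "entries (put_square T a b c d) \<subseteq> set (variants (a, b, c, d)) \<union> entries T"
  unfolding put_square_def by (auto dest!: subsetD[OF entries_put_cell])

lemma entries_empty [simp]: "entries empty_table = {}"
proof -
  have "cell empty_table a b = None" for a b
    by (cases a; cases b) (auto simp: cell_def empty_table_def Let_def)
  then show ?thesis by (auto simp: entries_def)
qed

lemma entries_put_squares: "entries (put_squares T ws) \<subseteq> set (all_variants ws) \<union> entries T"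
proof (induction T ws rule: put_squares.induct)
  case (2 T a b c d ws)
  have "set (all_variants ((a, b, c, d) # ws)) = set (variants (a, b, c, d)) \<union> set (all_variants ws)"
    by (simp add: all_variants_def del: variants.simps)
  then show ?case using 2 entries_put_square[of T a b c d] by (simp del: variants.simps) blast
qed (simp add: all_variants_def)

lemma entries_table_of: "entries (table_of ws) \<subseteq> set (all_variants ws)"
  using entries_put_squares[of empty_table ws] by (simp add: table_of_def)

fun filled :: "'a option \<Rightarrow> bool" where
  "filled None = False" | "filled (Some x) = True"

definition codes :: "code list" where "codes = [P1, N1, P2, N2]"

definition corners :: "(code \<times> code) list" where "corners = List.product codes codes"

lemma set_corners: "set corners = UNIV"
  by (auto simp: corners_def codes_def UNIV_code simp flip: UNIV_Times_UNIV)

definition total :: "table \<Rightarrow> bool" where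
  "total T = list_all (\<lambda>(a, b). filled (cell T a b)) corners"

lemma filled_iff: "filled x \<longleftrightarrow> (\<exists>y. x = Some y)" by (cases x) auto

lemma totalD: "total T \<Longrightarrow> \<exists>c d. cell T a b = Some (c, d)"
  using set_corners by (auto simp: total_def list_all_iff filled_iff)

lemma all_variants_total:
  "total (table_of ws) \<Longrightarrow> \<exists>c d. (a, b, c, d) \<in> set (all_variants ws)"
  using totalD[of "table_of ws" a b] entries_table_of[of ws] by (simp add: entries_def) blast

text \<open>The functions that are evaluated often are given by plain recursion equations, with intermediate
  results as arguments: evaluating a case distinction by \<open>code_simp\<close> would normalize all arguments of the
  selected branch again.\<close>

subsection \<open>Exhaustive search\<close>

datatype cmp = LT | EQ | GT

fun cmp_code :: "code \<Rightarrow> code \<Rightarrow> cmp" where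
  "cmp_code P1 P1 = EQ" | "cmp_code N1 N1 = EQ" | "cmp_code P2 P2 = EQ" | "cmp_code N2 N2 = EQ"
| "cmp_code P1 x = LT" | "cmp_code x P1 = GT" | "cmp_code N1 x = LT" | "cmp_code x N1 = GT"
| "cmp_code P2 x = LT" | "cmp_code x P2 = GT"

fun cmp_lex :: "cmp \<Rightarrow> cmp \<Rightarrow> cmp" where
  "cmp_lex EQ x = x" | "cmp_lex LT x = LT" | "cmp_lex GT x = GT"

fun cmp_cell :: "(code \<times> code) option \<Rightarrow> (code \<times> code) option \<Rightarrow> cmp" where
  "cmp_cell (Some (a, b)) (Some (c, d)) = cmp_lex (cmp_code a c) (cmp_code b d)"
| "cmp_cell None None = EQ" | "cmp_cell None (Some x) = LT" | "cmp_cell (Some x) None = GT"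

lemma cmp_code_EQ: "cmp_code a b = EQ \<longleftrightarrow> a = b" by (cases a; cases b) auto

lemma cmp_cell_EQ: "cmp_cell x (Some (c, d)) = EQ \<longleftrightarrow> x = Some (c, d)"
proof (cases x)
  case (Some p)
  then show ?thesis
    by (cases p; cases "cmp_code (fst p) c") (auto simp: cmp_code_EQ[symmetric])
qed simp

fun apply_signed :: "code \<times> code \<Rightarrow> code \<Rightarrow> code" where
  "apply_signed (x, y) P1 = x" | "apply_signed (x, y) N1 = bar x"
| "apply_signed (x, y) P2 = y" | "apply_signed (x, y) N2 = bar y"

text \<open>\<open>Sym g g' h h'\<close> stands for signed permutations \<open>g\<close> of the \<open>A\<close>-letters and \<open>h\<close> of the \<open>B\<close>-letters
  with inverses \<open>g'\<close> and \<open>h'\<close>.\<close>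

datatype sym = Sym "code \<times> code" "code \<times> code" "code \<times> code" "code \<times> code"

fun is_sym :: "sym \<Rightarrow> bool" where
  "is_sym (Sym g g' h h') = list_all (\<lambda>c. apply_signed g' (apply_signed g c) = c \<and> apply_signed g (apply_signed g' c) = c
      \<and> apply_signed h' (apply_signed h c) = c \<and> apply_signed h (apply_signed h' c) = c) codes"

fun map_cell :: "code \<times> code \<Rightarrow> code \<times> code \<Rightarrow> (code \<times> code) option \<Rightarrow> (code \<times> code) option" where
  "map_cell g h (Some (c, d)) = Some (apply_signed g c, apply_signed h d)"
| "map_cell g h None = None"

text \<open>One cell of the table moved by the inverse symmetry. The moved table is never built, so
  a comparison can stop at the first difference.\<close>

fun pulled_cell :: "table \<Rightarrow> sym \<Rightarrow> code \<times> code \<Rightarrow> (code \<times> code) option" where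
  "pulled_cell T (Sym g g' h h') (a, b) = map_cell g' h' (cell T (apply_signed g a) (apply_signed h b))"

text \<open>Lexicographic order of pulled back tables. The first argument is the outcome at the
  previous corner; a tie to the end counts as not less.\<close>

fun less_sym :: "cmp \<Rightarrow> table \<Rightarrow> sym \<Rightarrow> sym \<Rightarrow> (code \<times> code) list \<Rightarrow> bool" where
  "less_sym LT T s t ps = True"
| "less_sym GT T s t ps = False"
| "less_sym EQ T s t [] = False"
| "less_sym EQ T s t (p # ps) = less_sym (cmp_cell (pulled_cell T s p) (pulled_cell T t p)) T s t ps"

text \<open>\<open>t\<close> is the best symmetry so far, \<open>s\<close> its challenger, and the
  Boolean tells whether \<open>s\<close> has won.\<close>

fun best_sym :: "bool \<Rightarrow> table \<Rightarrow> sym \<Rightarrow> (code \<times> code) list \<Rightarrow> sym \<Rightarrow> sym list \<Rightarrow> sym" where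
  "best_sym True T s ps t [] = s"
| "best_sym False T s ps t [] = t"
| "best_sym True T s ps t (x # xs) = best_sym (less_sym EQ T x s ps) T x ps s xs"
| "best_sym False T s ps t (x # xs) = best_sym (less_sym EQ T x t ps) T x ps t xs"

text \<open>One word per square is compared; the remaining words of a square follow in every set
  closed under \<open>variants\<close>, as symmetries commute with them.\<close>

fun matches :: "cmp \<Rightarrow> table \<Rightarrow> sym \<Rightarrow> square list \<Rightarrow> bool" where
  "matches LT T s ws = False"
| "matches GT T s ws = False"
| "matches EQ T s [] = True"
| "matches EQ T s ((a, b, c, d) # ws) = matches (cmp_cell (pulled_cell T s (a, b)) (Some (c, d))) T s ws"

fun matches_any :: "bool \<Rightarrow> table \<Rightarrow> sym \<Rightarrow> square list list \<Rightarrow> bool" where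
  "matches_any True T s rs = True"
| "matches_any False T s [] = False"
| "matches_any False T s (r # rs) = matches_any (matches EQ T s r) T s rs"

text \<open>The choice of the symmetry with the least pulled back table is only a heuristic to find a
  match quickly; soundness does not depend on it.\<close>

fun classified :: "(code \<times> code) list \<Rightarrow> square list list \<Rightarrow> sym list \<Rightarrow> table \<Rightarrow> bool" where
  "classified ps rs [] T = False"
| "classified ps rs (x # xs) T = matches_any False T (best_sym False T x ps x xs) rs"

text \<open>The Boolean tells whether \<open>p\<close> is filled, and a list of length at most one
  serves as optional result. Starting with \<open>True\<close> makes the initial \<open>p\<close> a
  mere dummy.\<close>

fun first_free :: "bool \<Rightarrow> table \<Rightarrow> code \<times> code \<Rightarrow> (code \<times> code) list \<Rightarrow> (code \<times> code) list" where
  "first_free False T p ps = [p]"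
| "first_free True T p [] = []"
| "first_free True T p (q # ps) = first_free (filled (cell T (fst q) (snd q))) T q ps"

fun agree :: "(code \<times> code) option \<Rightarrow> code \<Rightarrow> code \<Rightarrow> bool" where
  "agree None a b = True" | "agree (Some (c, d)) a b = (c = a \<and> d = b)"

text \<open>The corner \<open>(a, b)\<close> itself is free when the search asks. Excluding
  \<open>a = c\<close>, \<open>b = d\<close> is exactly what makes the four corners of the square
  distinct.\<close>

definition fits :: "table \<Rightarrow> code \<Rightarrow> code \<Rightarrow> code \<Rightarrow> code \<Rightarrow> bool" where
  "fits T a b c d \<longleftrightarrow> \<not> (a = c \<and> b = d) \<and> agree (cell T c d) a b \<and>
    agree (cell T (bar a) (bar d)) (bar c) (bar b) \<and> agree (cell T (bar c) (bar b)) (bar a) (bar d)"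

fun extend :: "(table \<Rightarrow> bool) \<Rightarrow> bool \<Rightarrow> table \<Rightarrow> code \<Rightarrow> code \<Rightarrow> code \<Rightarrow> code \<Rightarrow> bool" where
  "extend P True T a b c d = P (put_square T a b c d)"
| "extend P False T a b c d = True"

text \<open>A conjunction over all ways to fill corner \<open>p\<close>; the Boolean is its value so
  far. Squares that do not fit pass vacuously through \<open>extend\<close>.\<close>

fun branch :: "(table \<Rightarrow> bool) \<Rightarrow> bool \<Rightarrow> table \<Rightarrow> code \<times> code \<Rightarrow> (code \<times> code) list \<Rightarrow> bool" where
  "branch P False T p qs = False"
| "branch P True T p [] = True"
| "branch P True T p (q # qs) =
    branch P (extend P (fits T (fst p) (snd p) (fst q) (snd q)) T (fst p) (snd p) (fst q) (snd q)) T p qs"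

text \<open>Running out of free corners while squares are still to be chosen counts as failure, so
  success of the search also rules this out.\<close>

fun branch_first :: "(table \<Rightarrow> bool) \<Rightarrow> (code \<times> code) list \<Rightarrow> table \<Rightarrow> (code \<times> code) list \<Rightarrow> bool" where
  "branch_first P ps T [] = False"
| "branch_first P ps T (p # _) = branch P True T p ps"

text \<open>The list of units is a unary counter for the number of squares still to be chosen.\<close>

primrec search :: "(table \<Rightarrow> bool) \<Rightarrow> (code \<times> code) list \<Rightarrow> unit list \<Rightarrow> table \<Rightarrow> bool" where
  "search P ps [] T = P T"
| "search P ps (u # us) T = branch_first (search P ps us) ps T (first_free True T (P1, P1) ps)"

lemma branch_extend:
  "branch P x T p qs \<Longrightarrow> q \<in> set qs \<Longrightarrow> fits T (fst p) (snd p) (fst q) (snd q) \<Longrightarrow>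
    P (put_square T (fst p) (snd p) (fst q) (snd q))"
proof (induction P x T p qs rule: branch.induct)
  case (3 P T p q' qs)
  let ?x = "extend P (fits T (fst p) (snd p) (fst q') (snd q')) T (fst p) (snd p) (fst q') (snd q')"
  have "?x" using "3.prems"(1) by (cases ?x) auto
  then show ?case using 3 by auto
qed auto

text \<open>The set \<open>V\<close> selects one path through the search tree: at the chosen corner
  it has a square, and this square fits because all present entries come from \<open>V\<close>,
  which has one square per corner.\<close>

lemma search_complete:
  assumes V: "valid V" and ps: "set ps = UNIV"
  shows "search P ps us T \<Longrightarrow> entries T \<subseteq> V \<Longrightarrow> \<exists>T'. entries T' \<subseteq> V \<and> P T'"
proof (induction us arbitrary: T)
  case (Cons u us)
  then obtain p where p: "branch (search P ps us) True T p ps"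
    by (cases "first_free True T (P1, P1) ps") auto
  obtain a b where ab: "p = (a, b)" by fastforce
  obtain c d where cd: "(a, b, c, d) \<in> V" using V unfolding valid_def by blast
  have sub: "set (variants (a, b, c, d)) \<subseteq> V" using cd V unfolding valid_def by blast
  have agree: "agree (cell T x y) z w" if "(x, y, z, w) \<in> V" for x y z w
  proof (cases "cell T x y")
    case (Some q)
    then have "(x, y, fst q, snd q) \<in> V" using Cons.prems(2) by (auto simp: entries_def)
    then show ?thesis using that V Some unfolding valid_def by (cases q) auto
  qed simp
  have "\<not> (a = c \<and> b = d)" using cd V unfolding valid_def by blast
  then have "fits T a b c d" using sub by (auto simp: fits_def intro!: agree)
  then have "search P ps us (put_square T a b c d)"
    using branch_extend[OF p, of "(c, d)"] ps ab by simp
  moreover have "entries (put_square T a b c d) \<subseteq> V"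
    using entries_put_square[of T a b c d] sub Cons.prems(2) by blast
  ultimately show ?case using Cons.IH by blast
qed auto

lemma apply_signed_bar: "apply_signed g (bar c) = bar (apply_signed g c)"
  by (cases g; cases c) auto

lemma is_symD:
  assumes "is_sym (Sym g g' h h')"
  shows "apply_signed g' (apply_signed g c) = c" "apply_signed g (apply_signed g' c) = c"
    "apply_signed h' (apply_signed h c) = c" "apply_signed h (apply_signed h' c) = c"
  using assms by (cases c; simp add: codes_def)+

lemma best_sym_mem: "best_sym x T s ps t xs \<in> set (s # t # xs)"
  by (induction x T s ps t xs rule: best_sym.induct) auto

lemma matches_any_ex: "matches_any x T s rs \<Longrightarrow> x \<or> (\<exists>r\<in>set rs. matches EQ T s r)"
  by (induction x T s rs rule: matches_any.induct) auto

definition sym_square :: "sym \<Rightarrow> square \<Rightarrow> square" where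
  "sym_square s w = (case s of Sym g g' h h' \<Rightarrow> case w of (a, b, c, d) \<Rightarrow>
     (apply_signed g a, apply_signed h b, apply_signed g c, apply_signed h d))"

lemma matches_entries:
  "matches x T s ws \<Longrightarrow> is_sym s \<Longrightarrow> x = EQ \<and> sym_square s ` set ws \<subseteq> entries T"
proof (induction x T s ws rule: matches.induct)
  case (4 T s a b c d ws)
  obtain g g' h h' where s: "s = Sym g g' h h'" by (cases s)
  note sym = is_symD[OF "4.prems"(2)[unfolded s]]
  have eq: "map_cell g' h' (cell T (apply_signed g a) (apply_signed h b)) = Some (c, d)"
    and IH: "sym_square s ` set ws \<subseteq> entries T"
    using "4.IH" "4.prems" s by (simp_all add: cmp_cell_EQ)
  then obtain c' d' where "cell T (apply_signed g a) (apply_signed h b) = Some (c', d')"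
    "apply_signed g' c' = c" "apply_signed h' d' = d"
    by (cases "cell T (apply_signed g a) (apply_signed h b)") auto
  then have "sym_square s (a, b, c, d) \<in> entries T"
    using sym s by (auto simp: entries_def sym_square_def)
  then show ?case using IH "4.prems" by (cases "cmp_cell (pulled_cell T s (a, b)) (Some (c, d))") auto
qed auto


subsection \<open>Isomorphisms given by word maps\<close>

definition word_class :: "square set \<Rightarrow> clet list \<Rightarrow> gen letter list set" where
  "word_class V w = pres_class gens (word ` V) (map to_letter w)"

lemma group_square_group: "group (square_group V)"
  unfolding square_group_def by (rule group_presented_group)

lemma word_class_closed: "word_class V w \<in> carrier (square_group V)"
  unfolding word_class_def square_group_def carrier_presented_group by (rule imageI) simp

lemma word_class_append: "word_class V (u @ v) = word_class V u \<otimes>\<^bsub>square_group V\<^esub> word_class V v"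
  unfolding word_class_def square_group_def by (subst pres_class_mult) simp_all

lemma word_class_Nil: "word_class V [] = \<one>\<^bsub>square_group V\<^esub>"
  by (simp add: word_class_def square_group_def one_presented_group)

lemma word_class_eq_word_val: "word_class V w = word_val (square_group V) (pres_gen gens (word ` V)) (map to_letter w)"
  unfolding word_class_def square_group_def by (subst word_val_pres_gen) simp_all

lemma word_class_cancel: "word_class V [l, cbar l] = word_class V []"
proof -
  have "pres_equiv gens (word ` V) ([] @ [to_letter l, inv_letter (to_letter l)] @ []) ([] @ [])"
    by (rule pres_equiv.cancel) (auto simp: letters_gens)
  then show ?thesis
    unfolding word_class_def by (subst pres_class_eq_iff) (auto simp: letters_gens inv_letter_to_letter)
qed

lemma word_class_square: "s \<in> V \<Longrightarrow> word_class V (square_word s) = word_class V []"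
  unfolding word_class_eq_word_val word_class_Nil
  by (simp add: square_group_def word_val_pres_gen_relator word_def[symmetric])
    (rule word_val_pres_gen_relator, use word_lists[of V] in auto)

lemma word_class_inverse: "word_class V (rev (map cbar w)) = inv\<^bsub>square_group V\<^esub> word_class V w"
proof -
  interpret group "square_group V" by (rule group_square_group)
  have "rev (map inv_letter (map to_letter w)) = map to_letter (rev (map cbar w))"
    by (simp add: rev_map inv_letter_to_letter)
  then show ?thesis
    unfolding word_class_eq_word_val
    using word_val_inverse[of "pres_gen gens (word ` V)" gens "map to_letter w"] pres_gen_closed[of gens "word ` V"]
    by (simp add: square_group_def)
qed

definition subst :: "(clet \<Rightarrow> clet list) \<Rightarrow> clet list \<Rightarrow> clet list" where
  "subst \<sigma> w = concat (map \<sigma> w)"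

text \<open>This makes substitution on signed letters agree with evaluation determined by the four
  generators.\<close>

definition inverse_compatible :: "(clet \<Rightarrow> clet list) \<Rightarrow> bool" where
  "inverse_compatible \<sigma> \<longleftrightarrow> (\<forall>l. \<sigma> (cbar l) = rev (map cbar (\<sigma> l)))"

fun gen_letter :: "gen \<Rightarrow> clet" where
  "gen_letter (GenA n) = (if n = 1 then A P1 else A P2)"
| "gen_letter (GenB n) = (if n = 1 then B P1 else B P2)"

lemma gens_cases: "x \<in> gens \<longleftrightarrow> x \<in> {GenA 1, GenA 2, GenB 1, GenB 2}"
  by (auto simp: gens_def A_gens_def B_gens_def atLeastAtMost_1_2)

lemma to_letter_gen_letter: "x \<in> gens \<Longrightarrow> to_letter (gen_letter x) = (x, True)"
  by (auto simp: gens_cases)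

lemma gen_letter_mem: "gen_letter x \<in> {A P1, A P2, B P1, B P2}"
  by (cases x) auto

lemma clet_cases:
  obtains x where "x \<in> gens" "l = gen_letter x" | x where "x \<in> gens" "l = cbar (gen_letter x)"
proof (cases l rule: to_letter.cases)
  case 1 then show ?thesis by (intro that(1)[of "GenA 1"]) (auto simp: gens_cases)
next
  case 2 then show ?thesis by (intro that(2)[of "GenA 1"]) (auto simp: gens_cases)
next
  case 3 then show ?thesis by (intro that(1)[of "GenA 2"]) (auto simp: gens_cases)
next
  case 4 then show ?thesis by (intro that(2)[of "GenA 2"]) (auto simp: gens_cases)
next
  case 5 then show ?thesis by (intro that(1)[of "GenB 1"]) (auto simp: gens_cases)
next
  case 6 then show ?thesis by (intro that(2)[of "GenB 1"]) (auto simp: gens_cases)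
next
  case 7 then show ?thesis by (intro that(1)[of "GenB 2"]) (auto simp: gens_cases)
next
  case 8 then show ?thesis by (intro that(2)[of "GenB 2"]) (auto simp: gens_cases)
qed

lemma word_val_subst:
  assumes "inverse_compatible \<sigma>"
  shows "word_val (square_group W) (\<lambda>x. word_class W (\<sigma> (gen_letter x))) (map to_letter w) = word_class W (subst \<sigma> w)"
proof (induction w)
  case Nil
  then show ?case by (simp add: subst_def word_class_Nil)
next
  case (Cons l w)
  have "lit_val (square_group W) (\<lambda>x. word_class W (\<sigma> (gen_letter x))) (to_letter l) = word_class W (\<sigma> l)"
  proof (cases rule: clet_cases[of l])
    case (1 x)
    then show ?thesis by (simp add: to_letter_gen_letter)
  next
    case (2 x)
    then have "to_letter l = (x, False)" by (simp add: inv_letter_to_letter[symmetric] to_letter_gen_letter)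
    then show ?thesis using 2 assms by (simp add: inverse_compatible_def word_class_inverse)
  qed
  then show ?case using Cons by (simp add: subst_def word_class_append)
qed

text \<open>The half-turn is a cyclic rotation of the relator, and the other two words are rotations
  of inverses of these.\<close>

lemma (in group) word_val_variants:
  assumes f: "f \<in> gens \<rightarrow> carrier G" and one: "word_val G f (word s) = \<one>" and t: "t \<in> set (variants s)"
  shows "word_val G f (word t) = \<one>"
proof -
  obtain a b c d where s: "s = (a, b, c, d)" by (cases s)
  define x where "x l = word_val G f [to_letter l]" for l
  have closed [simp]: "x l \<in> carrier G" for l
    unfolding x_def by (rule word_val_closed[OF f]) (auto simp: letters_gens)
  have x: "lit_val G f (to_letter l) = x l" for l
    using lit_val_closed[OF f, of "to_letter l"] by (auto simp: x_def letters_gens)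
  have bar: "x (cbar l) = inv (x l)" for l
    using lit_val_inv_letter[OF f, of "to_letter l"] by (simp add: x[symmetric] inv_letter_to_letter letters_gens)
  have A: "x (A (bar c)) = inv (x (A c))" and B: "x (B (bar c)) = inv (x (B c))" for c
    using bar[of "A c"] bar[of "B c"] by simp_all
  define p q where "p = x (A a) \<otimes> x (B b)" and "q = x (A c) \<otimes> x (B d)"
  have pq: "p \<in> carrier G" "q \<in> carrier G" by (simp_all add: p_def q_def)
  have one: "p \<otimes> q = \<one>" using one by (simp add: s word_def x m_assoc p_def q_def)
  then have q: "q = inv p" using pq by (metis inv_comm inv_equality)
  have 1: "q \<otimes> p = \<one>" using q pq by simp
  have two: "x (A a) \<otimes> (x (B b) \<otimes> (x (A c) \<otimes> x (B d))) = \<one>" "x (A c) \<otimes> (x (B d) \<otimes> (x (A a) \<otimes> x (B b))) = \<one>"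
    using one 1 by (simp_all add: p_def q_def m_assoc)
  have rot: "v \<otimes> u = \<one>" if "u \<otimes> v = \<one>" "u \<in> carrier G" "v \<in> carrier G" for u v
    using that inv_comm by blast
  have inv4: "inv a' \<otimes> (inv d' \<otimes> (inv c' \<otimes> inv b')) = \<one>"
    if "a' \<otimes> (b' \<otimes> (c' \<otimes> d')) = \<one>" "a' \<in> carrier G" "b' \<in> carrier G" "c' \<in> carrier G" "d' \<in> carrier G" for a' b' c' d'
  proof -
    have "inv (a' \<otimes> (b' \<otimes> (c' \<otimes> d'))) = \<one>" using that(1) by simp
    then have "(inv d' \<otimes> (inv c' \<otimes> inv b')) \<otimes> inv a' = \<one>" using that(2-) by (simp add: inv_mult_group m_assoc)
    then show ?thesis using rot that(2-) by blast
  qed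
  show ?thesis
    using t two inv4[OF two(1)] inv4[OF two(2)] unfolding s
    by (auto simp: word_def x A B m_assoc)
qed

text \<open>\<open>V'\<close> and \<open>W'\<close> supply one word per square; by
  \<open>word_val_variants\<close> no further relators have to be checked.\<close>

lemma square_group_isoI:
  assumes \<sigma>: "inverse_compatible \<sigma>" and \<tau>: "inverse_compatible \<tau>"
    and V: "V \<subseteq> (\<Union>s\<in>V'. set (variants s))" and W: "W \<subseteq> (\<Union>s\<in>W'. set (variants s))"
    and rels: "\<And>s. s \<in> V' \<Longrightarrow> word_class W (subst \<sigma> (square_word s)) = word_class W []"
      "\<And>s. s \<in> W' \<Longrightarrow> word_class V (subst \<tau> (square_word s)) = word_class V []"
    and inv: "\<And>l. l \<in> {A P1, A P2, B P1, B P2} \<Longrightarrow> word_class V (subst \<tau> (\<sigma> l)) = word_class V [l]"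
      "\<And>l. l \<in> {A P1, A P2, B P1, B P2} \<Longrightarrow> word_class W (subst \<sigma> (\<tau> l)) = word_class W [l]"
  shows "square_group V \<cong> square_group W"
proof -
  define f where "f = (\<lambda>x. word_class W (\<sigma> (gen_letter x)))"
  define g where "g = (\<lambda>x. word_class V (\<tau> (gen_letter x)))"
  have f: "f \<in> gens \<rightarrow> carrier (square_group W)" and g: "g \<in> gens \<rightarrow> carrier (square_group V)"
    by (auto simp: f_def g_def word_class_closed)
  \<comment> \<open>Stated for arbitrary data so that it serves both directions.\<close>
  have kills: "\<forall>r\<in>word ` V. word_val (square_group W) f r = \<one>\<^bsub>square_group W\<^esub>"
    if f: "f \<in> gens \<rightarrow> carrier (square_group W)" "f = (\<lambda>x. word_class W (\<sigma> (gen_letter x)))" and \<sigma>: "inverse_compatible \<sigma>"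
      and V: "V \<subseteq> (\<Union>s\<in>V'. set (variants s))" and rels: "\<And>s. s \<in> V' \<Longrightarrow> word_class W (subst \<sigma> (square_word s)) = word_class W []"
    for f V V' W \<sigma>
  proof clarify
    fix a b c d assume "(a, b, c, d) \<in> V"
    then obtain s where s: "s \<in> V'" "(a, b, c, d) \<in> set (variants s)" using V by blast
    have "word_val (square_group W) f (word s) = \<one>\<^bsub>square_group W\<^esub>"
      unfolding word_def f(2) word_val_subst[OF \<sigma>] using rels[OF s(1)] word_class_Nil by simp
    then show "word_val (square_group W) f (word (a, b, c, d)) = \<one>\<^bsub>square_group W\<^esub>"
      using group.word_val_variants[OF group_square_group f(1) _ s(2)] by blast
  qed
  note f' = kills[OF f f_def \<sigma> V rels(1)] and g' = kills[OF g g_def \<tau> W rels(2)]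
  have gen: "pres_gen gens (word ` U) x = word_class U [gen_letter x]" if "x \<in> gens" for U x
    using that by (simp add: pres_gen_def word_class_def to_letter_gen_letter)
  show ?thesis
    unfolding square_group_def
  proof (rule presented_group_isoI[of f _ _ _ _ g])
    show "pres_lift gens (word ` W) (presented_group gens (word ` V)) g (f x) = pres_gen gens (word ` V) x" if "x \<in> gens" for x
    proof -
      have "pres_lift gens (word ` W) (square_group V) g (pres_class gens (word ` W) (map to_letter (\<sigma> (gen_letter x))))
          = word_val (square_group V) g (map to_letter (\<sigma> (gen_letter x)))"
        by (rule pres_lift_class[OF group_square_group g g' map_to_letter_lists])
      then show ?thesis
        using inv(1)[OF gen_letter_mem] word_val_subst[OF \<tau>] gen[OF that]
        by (simp add: f_def g_def word_class_def square_group_def)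
    qed
    show "pres_lift gens (word ` V) (presented_group gens (word ` W)) f (g x) = pres_gen gens (word ` W) x" if "x \<in> gens" for x
    proof -
      have "pres_lift gens (word ` V) (square_group W) f (pres_class gens (word ` V) (map to_letter (\<tau> (gen_letter x))))
          = word_val (square_group W) f (map to_letter (\<tau> (gen_letter x)))"
        by (rule pres_lift_class[OF group_square_group f f' map_to_letter_lists])
      then show ?thesis
        using inv(2)[OF gen_letter_mem] word_val_subst[OF \<sigma>] gen[OF that]
        by (simp add: f_def g_def word_class_def square_group_def)
    qed
  qed (use f g f' g' in \<open>simp_all add: square_group_def\<close>)
qed

section \<open>Orbits and normal forms\<close>

lemma variants_sym_square: "set (variants (sym_square S s)) = sym_square S ` set (variants s)"
  by (cases S; cases s) (simp add: sym_square_def apply_signed_bar)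

text \<open>The four squares are only known to be sent into \<open>V\<close>. That every square of
  \<open>V\<close> is reached follows by comparing corners: the table is full, and \<open>V\<close>
  has a single square at each corner.\<close>

lemma square_group_sym_iso:
  assumes V: "valid V" and S: "is_sym S" and sub: "sym_square S ` set ws \<subseteq> V" and total: "total (table_of ws)"
  shows "square_group (set (all_variants ws)) \<cong> square_group V"
proof -
  obtain g g' h h' where S_eq: "S = Sym g g' h h'" by (cases S)
  note sym = is_symD[OF S[unfolded S_eq]]
  define \<sigma> where "\<sigma> = case_clet (\<lambda>c. [A (apply_signed g c)]) (\<lambda>c. [B (apply_signed h c)])"
  define \<tau> where "\<tau> = case_clet (\<lambda>c. [A (apply_signed g' c)]) (\<lambda>c. [B (apply_signed h' c)])"
  have compat: "inverse_compatible \<sigma>" "inverse_compatible \<tau>"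
    by (auto simp: inverse_compatible_def \<sigma>_def \<tau>_def apply_signed_bar split: clet.splits)
  have closed: "t \<in> V" if "s \<in> V" "t \<in> set (variants s)" for s t
    using that V unfolding valid_def by blast
  have image: "(apply_signed g a, apply_signed h b, apply_signed g c, apply_signed h d) \<in> V"
    if abcd: "(a, b, c, d) \<in> set (all_variants ws)" for a b c d
  proof -
    obtain s0 where s0: "s0 \<in> set ws" "(a, b, c, d) \<in> set (variants s0)"
      using abcd by (auto simp: all_variants_def simp del: variants.simps)
    obtain x y z w where s0_eq: "s0 = (x, y, z, w)" by (cases s0)
    note s = s0[unfolded s0_eq]
    have "sym_square S (x, y, z, w) \<in> V" using sub s(1) by blast
    moreover have "sym_square S (a, b, c, d) \<in> set (variants (sym_square S (x, y, z, w)))"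
      using s(2) unfolding variants_sym_square by (rule imageI)
    ultimately show ?thesis using closed by (auto simp: sym_square_def S_eq simp del: variants.simps)
  qed
  show ?thesis
  proof (rule square_group_isoI[OF compat])
    show "set (all_variants ws) \<subseteq> (\<Union>s\<in>set ws. set (variants s))" by (simp add: all_variants_def)
    show "V \<subseteq> (\<Union>s\<in>V. set (variants s))" using variants_self by blast
    show "word_class V (subst \<sigma> (square_word s)) = word_class V []" if "s \<in> set ws" for s
    proof -
      have "subst \<sigma> (square_word s) = square_word (sym_square S s)"
        by (cases s) (simp add: subst_def \<sigma>_def sym_square_def S_eq)
      then show ?thesis using word_class_square[of "sym_square S s" V] sub that by auto
    qed
    show "word_class (set (all_variants ws)) (subst \<tau> (square_word s)) = word_class (set (all_variants ws)) []" if s: "s \<in> V" for s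
    proof -
      obtain a b c d where s_eq: "s = (a, b, c, d)" by (cases s)
      obtain c' d' where cd: "(apply_signed g' a, apply_signed h' b, c', d') \<in> set (all_variants ws)"
        using all_variants_total[OF total] by blast
      then have "(a, b, apply_signed g c', apply_signed h d') \<in> V" using image[OF cd] sym by simp
      \<comment> \<open>Both squares of \<open>V\<close> sit at the corner
        \<open>(a, b)\<close>.\<close>
      then have "c = apply_signed g c' \<and> d = apply_signed h d'" using s s_eq V unfolding valid_def by blast
      then have "subst \<tau> (square_word s) = square_word (apply_signed g' a, apply_signed h' b, c', d')"
        using sym by (simp add: subst_def \<tau>_def s_eq)
      then show ?thesis using word_class_square[OF cd] by simp
    qed
    show "word_class (set (all_variants ws)) (subst \<tau> (\<sigma> l)) = word_class (set (all_variants ws)) [l]" for l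
      using sym by (cases l) (simp_all add: subst_def \<sigma>_def \<tau>_def)
    show "word_class V (subst \<sigma> (\<tau> l)) = word_class V [l]" for l
      using sym by (cases l) (simp_all add: subst_def \<sigma>_def \<tau>_def)
  qed
qed

lemma search_classifies:
  assumes V: "valid V" and syms: "list_all is_sym ss"
    and search: "search (classified corners rs ss) corners us empty_table"
  shows "\<exists>r\<in>set rs. \<exists>S. is_sym S \<and> sym_square S ` set r \<subseteq> V"
proof -
  obtain T where T: "entries T \<subseteq> V" "classified corners rs ss T"
    using search_complete[OF V set_corners search] by auto
  obtain x xs where ss: "ss = x # xs" using T(2) by (cases ss) auto
  define S where "S = best_sym False T x corners x xs"
  have "S \<in> set ss" using best_sym_mem[of False T x corners x xs] ss by (auto simp: S_def)
  then have "is_sym S" using syms by (simp add: list_all_iff)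
  moreover obtain r where r: "r \<in> set rs" "matches EQ T S r"
    using T(2) matches_any_ex[of False T S rs] ss by (auto simp: S_def)
  ultimately show ?thesis using matches_entries[OF r(2)] T(1) by blast
qed

text \<open>The word \<open>a\<^sup>-\<^sup>1 b\<^sup>-\<^sup>1 c d\<close> of a square allows to replace \<open>b a\<close> by \<open>c d\<close>, which moves \<open>B\<close>-letters to the
  right of \<open>A\<close>-letters.\<close>

fun push :: "table \<Rightarrow> code \<Rightarrow> code list \<Rightarrow> code list \<times> code" where
  "push T b [] = ([], b)"
| "push T b (a # u) = (case cell T (bar a) (bar b) of None \<Rightarrow> ([], b)
    | Some (c, d) \<Rightarrow> (case push T d u of (u', b') \<Rightarrow> (c # u', b')))"

fun reduced_cons :: "code \<Rightarrow> code list \<Rightarrow> code list" where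
  "reduced_cons a [] = [a]"
| "reduced_cons a (c # u) = (if c = bar a then u else a # c # u)"

text \<open>The word is read from the right, and \<open>(u, v)\<close> stands for the
  \<open>A\<close>-word \<open>u\<close> followed by the \<open>B\<close>-word \<open>v\<close>. A
  new \<open>B\<close>-letter has to travel through \<open>u\<close> and may change it on the
  way.\<close>

fun normal_form :: "table \<Rightarrow> clet list \<Rightarrow> code list \<times> code list" where
  "normal_form T [] = ([], [])"
| "normal_form T (A a # w) = (case normal_form T w of (u, v) \<Rightarrow> (reduced_cons a u, v))"
| "normal_form T (B b # w) = (case normal_form T w of (u, v) \<Rightarrow>
    (case push T b u of (u', b') \<Rightarrow> (u', reduced_cons b' v)))"

lemma word_class_Cons: "word_class V (l # w) = word_class V [l] \<otimes>\<^bsub>square_group V\<^esub> word_class V w"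
  using word_class_append[of V "[l]" w] by simp

lemma word_class_swap:
  assumes "(bar a, bar b, c, d) \<in> V"
  shows "word_class V [B b, A a] = word_class V [A c, B d]"
proof -
  interpret group "square_group V" by (rule group_square_group)
  have eq: "word_class V [A (bar a), B (bar b)] \<otimes>\<^bsub>square_group V\<^esub> word_class V [A c, B d] = \<one>\<^bsub>square_group V\<^esub>"
    using word_class_square[OF assms] word_class_append[of V "[A (bar a), B (bar b)]" "[A c, B d]"] by (simp add: word_class_Nil)
  have "word_class V [B b, A a] = inv\<^bsub>square_group V\<^esub> word_class V [A (bar a), B (bar b)]"
    using word_class_inverse[of V "[A (bar a), B (bar b)]"] by simp
  also have "\<dots> = word_class V [A c, B d]"
    by (intro inv_equality inv_comm[OF eq] word_class_closed)
  finally show ?thesis .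
qed

text \<open>Each move is one application of \<open>word_class_swap\<close>; totality excludes the
  default branch of \<open>push\<close>.\<close>

lemma word_class_push:
  assumes T: "total T" "entries T \<subseteq> V"
  shows "push T b u = (u', b') \<Longrightarrow> word_class V (B b # map A u) = word_class V (map A u' @ [B b'])"
proof (induction u arbitrary: b u' b')
  case (Cons a u)
  interpret group "square_group V" by (rule group_square_group)
  obtain c d where cd: "cell T (bar a) (bar b) = Some (c, d)" using totalD[OF T(1)] by blast
  obtain u'' where u'': "push T d u = (u'', b')" "u' = c # u''"
    using Cons.prems cd by (auto split: prod.splits)
  have "word_class V (B b # map A (a # u)) = word_class V [B b, A a] \<otimes>\<^bsub>square_group V\<^esub> word_class V (map A u)"
    by (simp flip: word_class_append)
  also have "word_class V [B b, A a] = word_class V [A c, B d]"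
    using cd T(2) by (intro word_class_swap) (auto simp: entries_def)
  also have "word_class V [A c, B d] \<otimes>\<^bsub>square_group V\<^esub> word_class V (map A u) = word_class V [A c] \<otimes>\<^bsub>square_group V\<^esub> word_class V (B d # map A u)"
    by (simp flip: word_class_append)
  also have "word_class V (B d # map A u) = word_class V (map A u'' @ [B b'])"
    by (rule Cons.IH[OF u''(1)])
  also have "word_class V [A c] \<otimes>\<^bsub>square_group V\<^esub> word_class V (map A u'' @ [B b']) = word_class V (map A u' @ [B b'])"
    using u''(2) by (simp flip: word_class_append)
  finally show ?case .
qed simp

lemma word_class_reduced_cons:
  assumes f: "\<And>c. cbar (f c) = f (bar c)"
  shows "word_class V (map f (reduced_cons a u)) = word_class V (f a # map f u)"
proof (cases u)
  case (Cons c u')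
  interpret group "square_group V" by (rule group_square_group)
  show ?thesis
  proof (cases "c = bar a")
    case True
    then have "f a # map f u = [f a, cbar (f a)] @ map f u'" using Cons f by simp
    then have "word_class V (f a # map f u) = word_class V [] \<otimes>\<^bsub>square_group V\<^esub> word_class V (map f u')"
      by (simp only: word_class_append word_class_cancel)
    also have "\<dots> = word_class V (map f u')" by (simp add: word_class_append[symmetric])
    finally show ?thesis using True Cons by simp
  qed (use Cons in simp)
qed simp

lemma word_class_normal_form:
  assumes T: "total T" "entries T \<subseteq> V"
  shows "normal_form T w = (u, v) \<Longrightarrow> word_class V w = word_class V (map A u @ map B v)"
proof (induction w arbitrary: u v)
  case (Cons l w)
  obtain u' v' where uv: "normal_form T w = (u', v')" by fastforce
  have IH: "word_class V (l # w) = word_class V (l # map A u' @ map B v')"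
    using Cons.IH[OF uv] word_class_Cons[of V l w] word_class_Cons[of V l "map A u' @ map B v'"] by simp
  show ?case
  proof (cases l)
    case (A a)
    have "u = reduced_cons a u'" "v = v'" using Cons.prems uv A by auto
    then show ?thesis
      using IH word_class_reduced_cons[of A V a u'] A word_class_append[of V "A a # map A u'" "map B v'"] word_class_append[of V "map A u" "map B v"]
      by simp
  next
    case (B b)
    obtain u'' b' where p: "push T b u' = (u'', b')" by fastforce
    have eqs: "u = u''" "v = reduced_cons b' v'" using Cons.prems uv p B by auto
    have "word_class V (l # map A u' @ map B v') = word_class V ((map A u'' @ [B b']) @ map B v')"
      using word_class_push[OF T p] word_class_append[of V "B b # map A u'" "map B v'"] word_class_append[of V "map A u'' @ [B b']" "map B v'"] B by simp
    also have "\<dots> = word_class V (map A u @ map B v)"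
      using eqs word_class_append[of V "map A u''"] word_class_reduced_cons[of B V b' v'] by simp
    finally show ?thesis using IH by simp
  qed
qed simp

section \<open>Certificates for isomorphisms\<close>

datatype sub = Sub "clet list" "clet list" "clet list" "clet list"

text \<open>Only the images of the four generators are listed; inverse letters get the formally
  inverse words, so compatibility is automatic.\<close>

fun sub_map :: "sub \<Rightarrow> clet \<Rightarrow> clet list" where
  "sub_map (Sub x y z w) (A P1) = x" | "sub_map (Sub x y z w) (A N1) = rev (map cbar x)"
| "sub_map (Sub x y z w) (A P2) = y" | "sub_map (Sub x y z w) (A N2) = rev (map cbar y)"
| "sub_map (Sub x y z w) (B P1) = z" | "sub_map (Sub x y z w) (B N1) = rev (map cbar z)"
| "sub_map (Sub x y z w) (B P2) = w" | "sub_map (Sub x y z w) (B N2) = rev (map cbar w)"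

lemma inverse_compatible_sub_map: "inverse_compatible (sub_map \<sigma>)"
proof -
  have "sub_map \<sigma> (cbar l) = rev (map cbar (sub_map \<sigma> l))" for l
    by (cases \<sigma>; cases l rule: to_letter.cases) (simp_all add: rev_map o_def)
  then show ?thesis by (simp add: inverse_compatible_def)
qed

definition kills :: "table \<Rightarrow> sub \<Rightarrow> square list \<Rightarrow> bool" where
  "kills T \<sigma> ws = list_all (\<lambda>s. normal_form T (subst (sub_map \<sigma>) (square_word s)) = ([], [])) ws"

definition inverts :: "table \<Rightarrow> sub \<Rightarrow> sub \<Rightarrow> bool" where
  "inverts T \<tau> \<sigma> = list_all (\<lambda>l. normal_form T (subst (sub_map \<tau>) (sub_map \<sigma> l)) = normal_form T [l]) [A P1, A P2, B P1, B P2]"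

text \<open>\<open>T\<close> and \<open>U\<close> are meant to be the tables of \<open>vs\<close>
  and \<open>ws\<close>. As \<sigma> sends letters of \<open>vs\<close> to words over
  \<open>ws\<close>, its results are normalized in \<open>U\<close>, and those of \<tau> in
  \<open>T\<close>.\<close>

definition isos :: "table \<Rightarrow> table \<Rightarrow> square list \<Rightarrow> square list \<Rightarrow> sub \<Rightarrow> sub \<Rightarrow> bool" where
  "isos T U vs ws \<sigma> \<tau> \<longleftrightarrow> total T \<and> total U \<and> kills U \<sigma> vs \<and> kills T \<tau> ws \<and> inverts T \<tau> \<sigma> \<and> inverts U \<sigma> \<tau>"

lemma isos_iso:
  assumes isos: "isos (table_of vs) (table_of ws) vs ws \<sigma> \<tau>"
  shows "square_group (set (all_variants vs)) \<cong> square_group (set (all_variants ws))"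
proof (rule square_group_isoI[OF inverse_compatible_sub_map inverse_compatible_sub_map])
  show "set (all_variants vs) \<subseteq> (\<Union>s\<in>set vs. set (variants s))" "set (all_variants ws) \<subseteq> (\<Union>s\<in>set ws. set (variants s))"
    by (simp_all add: all_variants_def)
  have totals: "total (table_of vs)" "total (table_of ws)" using isos by (simp_all add: isos_def)
  note inverts = isos[unfolded isos_def inverts_def list_all_iff list.set]
  have nf: "word_class (set (all_variants us)) w = word_class (set (all_variants us)) w'"
    if "total (table_of us)" "normal_form (table_of us) w = normal_form (table_of us) w'" for us w w'
  proof (cases "normal_form (table_of us) w'")
    case (Pair u v)
    then show ?thesis using word_class_normal_form[OF that(1) entries_table_of] that(2) by metis
  qed
  show "word_class (set (all_variants ws)) (subst (sub_map \<sigma>) (square_word s)) = word_class (set (all_variants ws)) []" if "s \<in> set vs" for s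
    by (rule nf[OF totals(2)]) (use isos that in \<open>auto simp: isos_def kills_def list_all_iff\<close>)
  show "word_class (set (all_variants vs)) (subst (sub_map \<tau>) (square_word s)) = word_class (set (all_variants vs)) []" if "s \<in> set ws" for s
    by (rule nf[OF totals(1)]) (use isos that in \<open>auto simp: isos_def kills_def list_all_iff\<close>)
  show "word_class (set (all_variants vs)) (subst (sub_map \<tau>) (sub_map \<sigma> l)) = word_class (set (all_variants vs)) [l]"
    if "l \<in> {A P1, A P2, B P1, B P2}" for l
    by (rule nf[OF totals(1)]) (use inverts that in blast)
  show "word_class (set (all_variants ws)) (subst (sub_map \<sigma>) (sub_map \<tau> l)) = word_class (set (all_variants ws)) [l]"
    if "l \<in> {A P1, A P2, B P1, B P2}" for l
    by (rule nf[OF totals(2)]) (use inverts that in blast)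
qed

section \<open>The orbits and the representatives\<close>

text \<open>The eight symmetries of a square, each with its inverse; only the two of order four are
  not their own inverses.\<close>

definition signed_perms :: "((code \<times> code) \<times> (code \<times> code)) list" where
  "signed_perms = [((P1, P2), (P1, P2)), ((P1, N2), (P1, N2)), ((N1, P2), (N1, P2)), ((N1, N2), (N1, N2)),
    ((P2, P1), (P2, P1)), ((P2, N1), (N2, P1)), ((N2, P1), (P2, N1)), ((N2, N1), (N2, N1))]"

text \<open>64 pairs, acting on each alphabet separately.\<close>

definition syms :: "sym list" where
  "syms = concat (map (\<lambda>(g, g'). map (\<lambda>(h, h'). Sym g g' h h') signed_perms) signed_perms)"

text \<open>Within its isomorphism class each representative was chosen to make counting its homomorphisms cheap.\<close>

definition reps :: "square list list" where
  "reps = [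
  [(P1,P1,P1,N1),(P1,P2,P1,N2),(P2,P1,P2,N1),(P2,P2,P2,N2)],
  [(P1,P1,P1,N1),(P1,P2,N1,P2),(P2,P1,N2,P1),(P2,P2,N2,P2)],
  [(P1,P1,P1,N1),(P1,P2,P1,N2),(P2,P1,N2,N1),(P2,P2,P2,N2)],
  [(P1,P1,P1,N1),(P1,P2,P1,N2),(P2,P1,P2,P2),(N2,P1,N2,P2)],
  [(P1,P1,N1,P1),(P1,P2,N1,P2),(P2,P1,P2,N1),(P2,P2,P2,N2)],
  [(P1,P1,N1,P1),(P1,P2,N1,N2),(P2,P1,P2,N1),(P2,P2,P2,N2)],
  [(P1,P1,P1,N1),(P1,P2,P1,N2),(P2,P1,N2,N1),(P2,P2,N2,N2)],
  [(P1,P1,P1,N1),(P1,P2,P1,N2),(P2,P1,N2,P2),(N2,P1,P2,P2)],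
  [(P1,P1,P1,N1),(P1,P2,P1,N2),(P2,P1,N2,P2),(N2,N1,P2,P2)],
  [(P1,P1,P1,N1),(P1,P2,N1,P2),(P2,P1,P2,P2),(N2,P1,N2,P2)],
  [(P1,P1,P1,N1),(P1,P2,N1,P2),(P2,P1,N2,P1),(P2,P2,P2,N2)],
  [(P1,P1,P1,N1),(P1,P2,N1,P2),(P2,P1,N2,P1),(P2,P2,N2,N2)],
  [(P1,P1,N1,P1),(P1,P2,N1,N2),(P2,P1,P2,N1),(P2,P2,N2,N2)],
  [(P1,P1,P1,N1),(P1,P2,N1,P2),(P2,P1,N2,P2),(N2,P1,P2,P2)],
  [(P1,P1,P1,N1),(P1,P2,N1,P2),(P2,P1,N2,P2),(N2,N1,P2,P2)],
  [(P1,P1,P1,N1),(P1,P2,N1,N2),(P2,P1,P2,P2),(N2,P1,N2,P2)],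
  [(P1,P1,N1,N1),(P1,P2,N1,P2),(P2,P1,P2,N1),(P2,P2,N2,N2)],
  [(P1,P1,P1,N1),(P1,P2,N1,N2),(P2,P1,N2,P2),(N2,P1,P2,P2)],
  [(P1,P1,P1,N1),(P1,P2,N1,N2),(P2,P1,N2,P2),(N2,N1,P2,P2)],
  [(P1,P1,N1,P1),(P1,P2,N1,P2),(P2,P1,P2,P2),(N2,P1,N2,P2)],
  [(P1,P1,N1,P1),(P1,P2,N1,N2),(P2,P1,P2,P2),(N2,P1,N2,P2)],
  [(P1,P1,N1,P1),(P1,P2,N1,P2),(P2,P1,N2,P2),(N2,P1,P2,P2)],
  [(P1,P1,N1,P1),(P1,P2,N1,N2),(P2,P1,N2,P2),(N2,P1,P2,P2)],
  [(P1,P1,N1,P1),(P1,P2,N1,P2),(P2,P1,N2,P2),(N2,N1,P2,P2)],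
  [(P1,P1,P2,P1),(P1,N1,P2,N1),(P1,P2,N2,P2),(P1,N2,N2,N2)],
  [(P1,P1,N1,N1),(P1,P2,N1,N2),(P2,P1,P2,P2),(N2,P1,N2,P2)],
  [(P1,P1,P2,P1),(P1,N1,P2,N1),(P1,P2,P2,N2),(P1,N2,P2,P2)],
  [(P1,P1,P2,N1),(P1,N1,N2,P1),(P1,P2,P2,P2),(P1,N2,P2,N2)],
  [(P1,P1,P2,P1),(P1,N1,P2,N1),(P1,P2,N2,N2),(P1,N2,N2,P2)],
  [(P1,P1,P1,P2),(P1,N1,P2,N1),(P1,N2,P2,N2),(P2,P1,P2,P2)],
  [(P1,P1,P1,P2),(P1,N1,P2,N1),(P1,N2,N2,N2),(N2,N1,N2,P2)],
  [(P1,P1,P2,P1),(P1,N1,P2,P2),(P1,N2,P2,N2),(P2,N1,P1,P2)],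
  [(P1,P1,P2,P1),(P1,N1,P2,P2),(P1,P2,P2,N2),(N1,P1,N2,P2)],
  [(P1,P1,P2,P1),(P1,N1,P2,P2),(P1,P2,N2,N2),(N1,P1,N2,P2)],
  [(P1,P1,N1,N1),(P1,P2,N1,N2),(P2,P1,N2,N1),(P2,P2,N2,N2)],
  [(P1,P1,N1,N1),(P1,P2,N1,N2),(P2,P1,N2,P2),(N2,P1,P2,P2)],
  [(P1,P1,P2,N1),(P1,N1,P2,P2),(P1,P2,P2,N2),(N1,N1,N2,P2)],
  [(P1,P1,P2,N1),(P1,N1,P2,P2),(P1,P2,N2,N2),(N1,N1,N2,P2)],
  [(P1,P1,P2,N1),(P1,N1,N2,P2),(P1,P2,P2,N2),(N1,N1,P2,P2)],
  [(P1,P1,P2,P2),(N1,P1,N2,P2),(P2,P1,P1,P2),(N2,P1,N1,P2)],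
  [(P1,P1,P2,P2),(N1,N1,N2,P2),(P2,N1,P1,P2),(N2,P1,N1,P2)]]"

text \<open>An entry \<open>(r, k, \<sigma>, \<tau>)\<close> consists of the least element \<open>r\<close> of an orbit under signed permutations, the index
  \<open>k\<close> of its representative, and mutually inverse isomorphisms between the two groups.\<close>

definition orbits :: "(square list \<times> nat \<times> sub \<times> sub) list" where
  "orbits = [
  ([(P1,P1,P1,N1),(P1,P2,P1,N2),(P2,P1,P2,N1),(P2,P2,P2,N2)], 0,
    Sub [A P1] [A P2] [B P1] [B P2],
    Sub [A P1] [A P2] [B P1] [B P2]),
  ([(P1,P1,P1,N1),(P1,P2,P1,N2),(P2,P1,P2,N1),(P2,P2,N2,P2)], 1,
    Sub [B P2] [B P1] [A P2] [A P1],
    Sub [B P2] [B P1] [A P2] [A P1]),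
  ([(P1,P1,P1,N1),(P1,P2,P1,N2),(P2,P1,P2,N1),(P2,P2,N2,N2)], 2,
    Sub [A P1] [A P2] [B P2] [B P1],
    Sub [A P1] [A P2] [B P2] [B P1]),
  ([(P1,P1,P1,N1),(P1,P2,P1,N2),(P2,P1,P2,P2),(P2,N1,P2,N2)], 3,
    Sub [A P1] [A P2] [B P1] [B P2],
    Sub [A P1] [A P2] [B P1] [B P2]),
  ([(P1,P1,P1,N1),(P1,P2,P1,N2),(P2,P1,N2,P1),(P2,P2,N2,P2)], 4,
    Sub [A P2] [A P1] [B P1] [B P2],
    Sub [A P2] [A P1] [B P1] [B P2]),
  ([(P1,P1,P1,N1),(P1,P2,P1,N2),(P2,P1,N2,P1),(P2,P2,N2,N2)], 5,
    Sub [A P2] [A P1] [B P1] [B P2],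
    Sub [A P2] [A P1] [B P1] [B P2]),
  ([(P1,P1,P1,N1),(P1,P2,P1,N2),(P2,P1,N2,N1),(P2,P2,N2,N2)], 6,
    Sub [A P1] [A P2] [B P1] [B P2],
    Sub [A P1] [A P2] [B P1] [B P2]),
  ([(P1,P1,P1,N1),(P1,P2,P1,N2),(P2,P1,N2,P2),(P2,P2,N2,P1)], 7,
    Sub [A P1] [A P2] [B P1] [B P2],
    Sub [A P1] [A P2] [B P1] [B P2]),
  ([(P1,P1,P1,N1),(P1,P2,P1,N2),(P2,P1,N2,P2),(P2,P2,N2,N1)], 8,
    Sub [A P1] [A P2] [B P1] [B P2],
    Sub [A P1] [A P2] [B P1] [B P2]),
  ([(P1,P1,P1,N1),(P1,P2,N1,P2),(P2,P1,P2,N1),(P2,P2,N2,P2)], 4,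
    Sub [B P1] [B P2] [A P1] [A P2],
    Sub [B P1] [B P2] [A P1] [A P2]),
  ([(P1,P1,P1,N1),(P1,P2,N1,P2),(P2,P1,P2,N1),(P2,P2,N2,N2)], 4,
    Sub [B P1] [B N1, B P2] [A P1, B P1] [A P2],
    Sub [A P1, B P1] [B P2] [A P1] [A P1, A P2]),
  ([(P1,P1,P1,N1),(P1,P2,N1,P2),(P2,P1,P2,P2),(P2,N1,P2,N2)], 9,
    Sub [A P1] [A P2] [B P1] [B P2],
    Sub [A P1] [A P2] [B P1] [B P2]),
  ([(P1,P1,P1,N1),(P1,P2,N1,P2),(P2,P1,N2,P1),(P2,P2,P2,N2)], 10,
    Sub [A P1] [A P2] [B P1] [B P2],
    Sub [A P1] [A P2] [B P1] [B P2]),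
  ([(P1,P1,P1,N1),(P1,P2,N1,P2),(P2,P1,N2,P1),(P2,P2,N2,P2)], 1,
    Sub [A P1] [A P2] [B P1] [B P2],
    Sub [A P1] [A P2] [B P1] [B P2]),
  ([(P1,P1,P1,N1),(P1,P2,N1,P2),(P2,P1,N2,P1),(P2,P2,N2,N2)], 11,
    Sub [A P1] [A P2] [B P1] [B P2],
    Sub [A P1] [A P2] [B P1] [B P2]),
  ([(P1,P1,P1,N1),(P1,P2,N1,P2),(P2,P1,N2,N1),(P2,P2,P2,N2)], 11,
    Sub [B P1] [B P2] [A P2] [A P1],
    Sub [B P2] [B P1] [A P1] [A P2]),
  ([(P1,P1,P1,N1),(P1,P2,N1,P2),(P2,P1,N2,N1),(P2,P2,N2,P2)], 5,
    Sub [B P1] [B P2] [A P1] [A P2],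
    Sub [B P1] [B P2] [A P1] [A P2]),
  ([(P1,P1,P1,N1),(P1,P2,N1,P2),(P2,P1,N2,N1),(P2,P2,N2,N2)], 12,
    Sub [B P1] [B P2] [A P1] [A P2],
    Sub [B P1] [B P2] [A P1] [A P2]),
  ([(P1,P1,P1,N1),(P1,P2,N1,P2),(P2,P1,N2,P2),(P2,P2,N2,P1)], 13,
    Sub [A P1] [A P2] [B P1] [B P2],
    Sub [A P1] [A P2] [B P1] [B P2]),
  ([(P1,P1,P1,N1),(P1,P2,N1,P2),(P2,P1,N2,P2),(P2,P2,N2,N1)], 14,
    Sub [A P1] [A P2] [B P1] [B P2],
    Sub [A P1] [A P2] [B P1] [B P2]),
  ([(P1,P1,P1,N1),(P1,P2,N1,N2),(P2,P1,P2,N1),(P2,P2,N2,N2)], 0,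
    Sub [A P1] [A P2] [B P1] [B N1, B P2],
    Sub [A P1] [A P2] [B P1] [B P1, B P2]),
  ([(P1,P1,P1,N1),(P1,P2,N1,N2),(P2,P1,P2,P2),(P2,N1,P2,N2)], 15,
    Sub [A P1] [A P2] [B P1] [B P2],
    Sub [A P1] [A P2] [B P1] [B P2]),
  ([(P1,P1,P1,N1),(P1,P2,N1,N2),(P2,P1,N2,P1),(P2,P2,N2,P2)], 4,
    Sub [A P2] [A P1, B P1] [B P1] [B N1, B P2],
    Sub [A P2, B N1] [A P1] [B P1] [B P1, B P2]),
  ([(P1,P1,P1,N1),(P1,P2,N1,N2),(P2,P1,N2,P1),(P2,P2,N2,N2)], 12,
    Sub [A P2] [A P1] [B P1] [B P2],
    Sub [A P2] [A P1] [B P1] [B P2]),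
  ([(P1,P1,P1,N1),(P1,P2,N1,N2),(P2,P1,N2,N1),(P2,P2,P2,N2)], 2,
    Sub [A P1] [A P2] [B P1] [B N1, B P2],
    Sub [A P1] [A P2] [B P1] [B P1, B P2]),
  ([(P1,P1,P1,N1),(P1,P2,N1,N2),(P2,P1,N2,N1),(P2,P2,N2,P2)], 16,
    Sub [A P2] [A P1] [B P1] [B P2],
    Sub [A P2] [A P1] [B P1] [B P2]),
  ([(P1,P1,P1,N1),(P1,P2,N1,N2),(P2,P1,N2,N1),(P2,P2,N2,N2)], 6,
    Sub [A P1] [A P2] [B P1] [B N1, B P2],
    Sub [A P1] [A P2] [B P1] [B P1, B P2]),
  ([(P1,P1,P1,N1),(P1,P2,N1,N2),(P2,P1,N2,P2),(P2,P2,N2,P1)], 17,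
    Sub [A P1] [A P2] [B P1] [B P2],
    Sub [A P1] [A P2] [B P1] [B P2]),
  ([(P1,P1,P1,N1),(P1,P2,N1,N2),(P2,P1,N2,P2),(P2,P2,N2,N1)], 18,
    Sub [A P1] [A P2] [B P1] [B P2],
    Sub [A P1] [A P2] [B P1] [B P2]),
  ([(P1,P1,P1,N1),(P1,P2,P2,P2),(P1,N2,P2,N2),(P2,P1,P2,N1)], 19,
    Sub [B P1] [B P2] [A P1] [A P2],
    Sub [B P1] [B P2] [A P1] [A P2]),
  ([(P1,P1,P1,N1),(P1,P2,P2,P2),(P1,N2,P2,N2),(P2,P1,N2,P1)], 9,
    Sub [B P2] [B P1] [A P1] [A P2],
    Sub [B P1] [B P2] [A P2] [A P1]),
  ([(P1,P1,P1,N1),(P1,P2,P2,P2),(P1,N2,P2,N2),(P2,P1,N2,N1)], 20,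
    Sub [B P1] [B P2] [A P1] [A P2],
    Sub [B P1] [B P2] [A P1] [A P2]),
  ([(P1,P1,P1,N1),(P1,P2,P2,N2),(P1,N2,P2,P2),(P2,P1,P2,N1)], 21,
    Sub [B P1] [B P2] [A P1] [A P2],
    Sub [B P1] [B P2] [A P1] [A P2]),
  ([(P1,P1,P1,N1),(P1,P2,P2,N2),(P1,N2,P2,P2),(P2,P1,N2,P1)], 13,
    Sub [B P2] [B P1] [A P1] [A P2],
    Sub [B P1] [B P2] [A P2] [A P1]),
  ([(P1,P1,P1,N1),(P1,P2,P2,N2),(P1,N2,P2,P2),(P2,P1,N2,N1)], 22,
    Sub [B P1] [B P2] [A P1] [A P2],
    Sub [B P1] [B P2] [A P1] [A P2]),
  ([(P1,P1,P1,N1),(P1,P2,P2,N2),(P1,N2,N2,P2),(P2,P1,P2,N1)], 23,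
    Sub [B P1] [B P2] [A P1] [A N2],
    Sub [B P1] [B N2] [A P1] [A P2]),
  ([(P1,P1,P1,N1),(P1,P2,P2,N2),(P1,N2,N2,P2),(P2,P1,N2,P1)], 14,
    Sub [B P2] [B P1] [A P1] [A P2],
    Sub [B P1] [B P2] [A P2] [A P1]),
  ([(P1,P1,P1,N1),(P1,P2,P2,N2),(P1,N2,N2,P2),(P2,P1,N2,N1)], 22,
    Sub [B P1] [B P2] [A P1] [A N2, A P1],
    Sub [B P1] [B P1, B N2] [A P1] [A P2]),
  ([(P1,P1,P1,P2),(P1,N1,P1,N2),(P2,P1,P2,P2),(P2,N1,P2,N2)], 3,
    Sub [A P2] [A N2, A P1] [A N2, B P1] [A N2, B N1],
    Sub [A P1, A P2] [A P1] [A P1, B P1] [A P1, B N1]),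
  ([(P1,P1,P1,P2),(P1,N1,P1,N2),(P2,P1,P2,N2),(P2,N1,P2,P2)], 24,
    Sub [B P1] [B P2] [A P1] [A P2],
    Sub [B P1] [B P2] [A P1] [A P2]),
  ([(P1,P1,P1,P2),(P1,N1,P1,N2),(P2,P1,N2,P1),(P2,P2,N2,P2)], 19,
    Sub [A P2] [A P1] [B P1] [B P2],
    Sub [A P2] [A P1] [B P1] [B P2]),
  ([(P1,P1,P1,P2),(P1,N1,P1,N2),(P2,P1,N2,P1),(P2,P2,N2,N2)], 20,
    Sub [A P2] [A P1] [B P1] [B P2],
    Sub [A P2] [A P1] [B P1] [B P2]),
  ([(P1,P1,P1,P2),(P1,N1,P1,N2),(P2,P1,N2,N1),(P2,P2,N2,N2)], 25,
    Sub [A P2] [A P1] [B P1] [B P2],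
    Sub [A P2] [A P1] [B P1] [B P2]),
  ([(P1,P1,P1,P2),(P1,N1,P1,N2),(P2,P1,N2,P2),(P2,P2,N2,P1)], 26,
    Sub [B P1] [B P2] [A P1] [A P2],
    Sub [B P1] [B P2] [A P1] [A P2]),
  ([(P1,P1,P1,P2),(P1,N1,P1,N2),(P2,P1,N2,P2),(P2,P2,N2,N1)], 27,
    Sub [B P2] [B P1] [A P2] [A P1],
    Sub [B P2] [B P1] [A P2] [A P1]),
  ([(P1,P1,P1,P2),(P1,N1,P1,N2),(P2,P1,N2,N2),(P2,P2,N2,N1)], 28,
    Sub [B P1] [B P2] [A P1] [A P2],
    Sub [B P1] [B P2] [A P1] [A P2]),
  ([(P1,P1,P1,P2),(P1,N1,P2,N1),(P1,N2,P2,N2),(P2,P1,P2,P2)], 29,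
    Sub [A P1] [A P2] [B P1] [B P2],
    Sub [A P1] [A P2] [B P1] [B P2]),
  ([(P1,P1,P1,P2),(P1,N1,P2,N1),(P1,N2,N2,N2),(P2,P1,P2,N2)], 30,
    Sub [A P1] [A P2] [B P1] [B P2],
    Sub [A P1] [A P2] [B P1] [B P2]),
  ([(P1,P1,P1,P2),(P1,N1,P2,N2),(P1,N2,P2,N1),(P2,P1,P2,P2)], 31,
    Sub [B P1] [B N2] [A P1] [A P2],
    Sub [B P1] [B P2] [A P1] [A N2]),
  ([(P1,P1,P1,P2),(P1,N1,P2,N2),(P1,N2,N2,N1),(P2,P1,N2,P2)], 32,
    Sub [B P1] [B P2] [A P2] [A P1],
    Sub [B P2] [B P1] [A P1] [A P2]),
  ([(P1,P1,P1,P2),(P1,N1,P2,N2),(P1,N2,N2,N1),(P2,P1,N2,N2)], 33,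
    Sub [B P1] [B P2] [A P2] [A P1],
    Sub [B P2] [B P1] [A P1] [A P2]),
  ([(P1,P1,N1,P1),(P1,P2,N1,P2),(P2,P1,N2,P1),(P2,P2,N2,P2)], 0,
    Sub [B P1] [B P2] [A P1] [A P2],
    Sub [B P1] [B P2] [A P1] [A P2]),
  ([(P1,P1,N1,P1),(P1,P2,N1,P2),(P2,P1,N2,P1),(P2,P2,N2,N2)], 2,
    Sub [B P2] [B P1] [A P1] [A P2],
    Sub [B P1] [B P2] [A P2] [A P1]),
  ([(P1,P1,N1,P1),(P1,P2,N1,P2),(P2,P1,N2,N1),(P2,P2,N2,N2)], 0,
    Sub [B P1] [B N1, B P2] [A P1] [A P2],
    Sub [B P1] [B P2] [A P1] [A P1, A P2]),
  ([(P1,P1,N1,P1),(P1,P2,N1,P2),(P2,P1,N2,P2),(P2,P2,N2,P1)], 21,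
    Sub [A P1] [A P2] [B P1] [B P2],
    Sub [A P1] [A P2] [B P1] [B P2]),
  ([(P1,P1,N1,P1),(P1,P2,N1,P2),(P2,P1,N2,P2),(P2,P2,N2,N1)], 23,
    Sub [A P1] [A P2] [B P1] [B P2],
    Sub [A P1] [A P2] [B P1] [B P2]),
  ([(P1,P1,N1,P1),(P1,P2,N1,N2),(P2,P1,N2,P1),(P2,P2,N2,N2)], 6,
    Sub [B P1] [B P2] [A P1] [A P2],
    Sub [B P1] [B P2] [A P1] [A P2]),
  ([(P1,P1,N1,P1),(P1,P2,N1,N2),(P2,P1,N2,N1),(P2,P2,N2,P2)], 2,
    Sub [B P1] [B N1, B P2] [A P1] [A P2],
    Sub [B P1] [B P2] [A P1] [A P1, A P2]),
  ([(P1,P1,N1,P1),(P1,P2,N1,N2),(P2,P1,N2,N1),(P2,P2,N2,N2)], 6,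
    Sub [B P1] [B N1, B P2] [A P1] [A P2],
    Sub [B P1] [B P2] [A P1] [A P1, A P2]),
  ([(P1,P1,N1,P1),(P1,P2,N1,N2),(P2,P1,N2,P2),(P2,P2,N2,P1)], 22,
    Sub [A P1] [A P2] [B P1] [B P2],
    Sub [A P1] [A P2] [B P1] [B P2]),
  ([(P1,P1,N1,P1),(P1,P2,N1,N2),(P2,P1,N2,P2),(P2,P2,N2,N1)], 22,
    Sub [A P1] [A N1, A P2] [B P1] [B P2],
    Sub [A P1] [A P1, A P2] [B P1] [B P2]),
  ([(P1,P1,N1,P1),(P1,P2,P2,P2),(P1,N2,P2,N2),(P2,P1,N2,P1)], 3,
    Sub [B P1] [B P2] [A P1] [A P2],
    Sub [B P1] [B P2] [A P1] [A P2]),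
  ([(P1,P1,N1,P1),(P1,P2,P2,P2),(P1,N2,P2,N2),(P2,P1,N2,N1)], 15,
    Sub [B P1] [B P2] [A P1] [A P2],
    Sub [B P1] [B P2] [A P1] [A P2]),
  ([(P1,P1,N1,P1),(P1,P2,P2,N2),(P1,N2,P2,P2),(P2,P1,N2,P1)], 7,
    Sub [B P1] [B P2] [A P1] [A P2],
    Sub [B P1] [B P2] [A P1] [A P2]),
  ([(P1,P1,N1,P1),(P1,P2,P2,N2),(P1,N2,P2,P2),(P2,P1,N2,N1)], 17,
    Sub [B P1] [B P2] [A P1] [A P2],
    Sub [B P1] [B P2] [A P1] [A P2]),
  ([(P1,P1,N1,P1),(P1,P2,P2,N2),(P1,N2,N2,P2),(P2,P1,N2,P1)], 8,
    Sub [B P1] [B N2] [A P1] [A P2],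
    Sub [B P1] [B P2] [A P1] [A N2]),
  ([(P1,P1,N1,P1),(P1,P2,P2,N2),(P1,N2,N2,P2),(P2,P1,N2,N1)], 18,
    Sub [B P1] [B N2] [A P1] [A P2],
    Sub [B P1] [B P2] [A P1] [A N2]),
  ([(P1,P1,N1,N1),(P1,P2,N1,N2),(P2,P1,N2,N1),(P2,P2,N2,N2)], 34,
    Sub [A P1] [A P2] [B P1] [B P2],
    Sub [A P1] [A P2] [B P1] [B P2]),
  ([(P1,P1,N1,N1),(P1,P2,N1,N2),(P2,P1,N2,P2),(P2,P2,N2,P1)], 35,
    Sub [A P1] [A P2] [B P1] [B P2],
    Sub [A P1] [A P2] [B P1] [B P2]),
  ([(P1,P1,N1,N1),(P1,P2,N1,N2),(P2,P1,N2,P2),(P2,P2,N2,N1)], 23,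
    Sub [A N2, A P1, A N2] [A P2] [B P1] [B P2],
    Sub [A P2, A P1, A P2] [A P2] [B P1] [B P2]),
  ([(P1,P1,N1,N1),(P1,P2,P2,P2),(P1,N2,P2,N2),(P2,P1,N2,N1)], 25,
    Sub [B P1] [B P2] [A P1] [A P2],
    Sub [B P1] [B P2] [A P1] [A P2]),
  ([(P1,P1,N1,N1),(P1,P2,P2,N2),(P1,N2,P2,P2),(P2,P1,N2,N1)], 35,
    Sub [B P1] [B P2] [A P1] [A P2],
    Sub [B P1] [B P2] [A P1] [A P2]),
  ([(P1,P1,N1,N1),(P1,P2,P2,N2),(P1,N2,N2,P2),(P2,P1,N2,N1)], 23,
    Sub [B P1] [B N2] [A N2, A P1, A N2] [A P2],
    Sub [B P2, B P1, B P2] [B P2] [A P1] [A N2]),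
  ([(P1,P1,N1,P2),(P1,P2,N1,P1),(P2,P1,N2,P2),(P2,P2,N2,P1)], 35,
    Sub [A P2] [A N2, A P1] [B P1] [B P2],
    Sub [A P1, A P2] [A P1] [B P1] [B P2]),
  ([(P1,P1,N1,P2),(P1,P2,N1,P1),(P2,P1,N2,P2),(P2,P2,N2,N1)], 22,
    Sub [A P2] [A N1, A P2] [B P1] [B P2],
    Sub [A P1, A N2] [A P1] [B P1] [B P2]),
  ([(P1,P1,N1,P2),(P1,P2,N1,P1),(P2,P1,N2,N2),(P2,P2,N2,N1)], 21,
    Sub [A P2] [A N2, A P1] [B P1] [B P2],
    Sub [A P1, A P2] [A P1] [B P1] [B P2]),
  ([(P1,P1,N1,P2),(P1,P2,N1,N1),(P2,P1,N2,P2),(P2,P2,N2,N1)], 23,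
    Sub [A P2] [A N2, A P1] [B P1] [B P2],
    Sub [A P1, A P2] [A P1] [B P1] [B P2]),
  ([(P1,P1,N1,P2),(P1,P2,P2,P1),(P1,N2,P2,N1),(P2,P2,N2,P1)], 36,
    Sub [B P1] [B N2] [A P2] [A P1],
    Sub [B P2] [B P1] [A P1] [A N2]),
  ([(P1,P1,N1,P2),(P1,P2,P2,P1),(P1,N2,P2,N1),(P2,P2,N2,N1)], 37,
    Sub [B P1] [B N2] [A P2] [A P1],
    Sub [B P2] [B P1] [A P1] [A N2]),
  ([(P1,P1,N1,P2),(P1,P2,P2,N1),(P1,N2,P2,P1),(P2,P2,N2,P1)], 38,
    Sub [B P1] [B N2] [A P2] [A P1],
    Sub [B P2] [B P1] [A P1] [A N2]),
  ([(P1,P1,P2,P1),(P1,N1,P2,N1),(P1,P2,P2,P2),(P1,N2,P2,N2)], 3,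
    Sub [A N2, B P1] [A N2, B N1] [A P2] [A N2, A P1],
    Sub [B P1, B P2] [B P1] [A N2, B N1] [A P2, B N1]),
  ([(P1,P1,P2,P1),(P1,N1,P2,N1),(P1,P2,P2,N2),(P1,N2,P2,P2)], 26,
    Sub [A P1] [A P2] [B P1] [B P2],
    Sub [A P1] [A P2] [B P1] [B P2]),
  ([(P1,P1,P2,P1),(P1,N1,P2,N1),(P1,P2,P2,N2),(P1,N2,N2,P2)], 27,
    Sub [A P1] [A P2] [B P2] [B P1],
    Sub [A P1] [A P2] [B P2] [B P1]),
  ([(P1,P1,P2,P1),(P1,N1,P2,N1),(P1,P2,N2,P2),(P1,N2,N2,N2)], 24,
    Sub [A P1] [A P2] [B P1] [B P2],
    Sub [A P1] [A P2] [B P1] [B P2]),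
  ([(P1,P1,P2,P1),(P1,N1,P2,N1),(P1,P2,N2,N2),(P1,N2,N2,P2)], 28,
    Sub [A P1] [A P2] [B P1] [B P2],
    Sub [A P1] [A P2] [B P1] [B P2]),
  ([(P1,P1,P2,P1),(P1,N1,P2,P2),(P1,P2,P2,N1),(P1,N2,P2,N2)], 31,
    Sub [A P1] [A P2] [B P1] [B P2],
    Sub [A P1] [A P2] [B P1] [B P2]),
  ([(P1,P1,P2,P1),(P1,N1,P2,P2),(P1,P2,P2,N2),(P1,N2,P2,N1)], 32,
    Sub [A P1] [A P2] [B P1] [B P2],
    Sub [A P1] [A P2] [B P1] [B P2]),
  ([(P1,P1,P2,P1),(P1,N1,P2,P2),(P1,P2,N2,N2),(P1,N2,P2,N1)], 33,
    Sub [A P1] [A P2] [B P1] [B P2],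
    Sub [A P1] [A P2] [B P1] [B P2]),
  ([(P1,P1,P2,N1),(P1,N1,P2,P1),(P1,P2,P2,N2),(P1,N2,P2,P2)], 35,
    Sub [B P1] [B P2] [A P2] [A N2, A P1],
    Sub [B P1, B P2] [B P1] [A P1] [A P2]),
  ([(P1,P1,P2,N1),(P1,N1,P2,P1),(P1,P2,P2,N2),(P1,N2,N2,P2)], 22,
    Sub [B P2] [B P1] [A P2] [A N1, A P2],
    Sub [B P1, B N2] [B P1] [A P2] [A P1]),
  ([(P1,P1,P2,N1),(P1,N1,P2,P1),(P1,P2,N2,N2),(P1,N2,N2,P2)], 21,
    Sub [B P1] [B P2] [A P2] [A N2, A P1],
    Sub [B P1, B P2] [B P1] [A P1] [A P2]),
  ([(P1,P1,P2,N1),(P1,N1,P2,P2),(P1,P2,P2,N2),(P1,N2,P2,P1)], 36,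
    Sub [A P1] [A P2] [B P1] [B P2],
    Sub [A P1] [A P2] [B P1] [B P2]),
  ([(P1,P1,P2,N1),(P1,N1,P2,P2),(P1,P2,N2,N2),(P1,N2,P2,P1)], 37,
    Sub [A P1] [A P2] [B P1] [B P2],
    Sub [A P1] [A P2] [B P1] [B P2]),
  ([(P1,P1,P2,N1),(P1,N1,N2,P1),(P1,P2,P2,N2),(P1,N2,N2,P2)], 23,
    Sub [B P1] [B N2] [A P2] [A N2, A P1],
    Sub [B P1, B P2] [B P1] [A P1] [A N2]),
  ([(P1,P1,P2,N1),(P1,N1,N2,P2),(P1,P2,P2,N2),(P1,N2,N2,P1)], 38,
    Sub [A P1] [A P2] [B P1] [B P2],
    Sub [A P1] [A P2] [B P1] [B P2]),
  ([(P1,P1,P2,P2),(P1,N1,P2,N2),(P1,P2,P2,P1),(P1,N2,P2,N1)], 39,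
    Sub [A P1] [A P2] [B P1] [B P2],
    Sub [A P1] [A P2] [B P1] [B P2]),
  ([(P1,P1,P2,P2),(P1,N1,P2,N2),(P1,P2,P2,N1),(P1,N2,P2,P1)], 40,
    Sub [A P1] [A P2] [B P1] [B P2],
    Sub [A P1] [A P2] [B P1] [B P2]),
  ([(P1,P1,P2,P2),(P1,N1,N2,N2),(P1,P2,N2,P1),(P1,N2,P2,N1)], 40,
    Sub [B P1] [B N2] [A P1] [A P2],
    Sub [B P1] [B P2] [A P1] [A N2])]"

fun orbit_ok :: "square list \<times> nat \<times> sub \<times> sub \<Rightarrow> bool" where
  "orbit_ok (r, k, \<sigma>, \<tau>) \<longleftrightarrow> k < length reps \<and> isos (table_of r) (table_of (reps ! k)) r (reps ! k) \<sigma> \<tau>"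

lemma list_all_is_sym: "list_all is_sym syms" by code_simp

lemma list_all_orbit_ok: "list_all orbit_ok orbits" by code_simp

text \<open>The four units reflect the \<open>2 * 2\<close> squares of a relation. Each completed
  table is thereby a symmetric image of a listed orbit element.\<close>

lemma search_orbits: "search (classified corners (map fst orbits) syms) corners [(), (), (), ()] empty_table"
  by code_simp

lemma reps_ok: "list_all (\<lambda>ws. length ws = 4 \<and> total (table_of ws)) reps" by code_simp

section \<open>Counting homomorphisms to finite groups\<close>

text \<open>List access by bare pattern matching, suited to rewriting with unary numbers.\<close>

fun at :: "'a list \<Rightarrow> nat \<Rightarrow> 'a" where
  "at (x # xs) 0 = x"
| "at (x # xs) (Suc n) = at xs n"
| "at [] n = undefined"

lemma at_nth: "n < length xs \<Longrightarrow> at xs n = xs ! n"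
  by (induction xs n rule: at.induct) auto

definition mul :: "nat list list \<Rightarrow> nat \<Rightarrow> nat \<Rightarrow> nat" where
  "mul T x y = at (at T x) y"

definition table_group :: "nat list list \<Rightarrow> nat monoid" where
  "table_group T = \<lparr>carrier = {..<length T}, mult = mul T, one = 0\<rparr>"

text \<open>The innermost of three loops; the product \<open>xy\<close> is handed over so that it is
  computed once for all \<open>z\<close>.\<close>

fun assoc_3 :: "bool \<Rightarrow> nat list list \<Rightarrow> nat \<Rightarrow> nat \<Rightarrow> nat \<Rightarrow> nat list \<Rightarrow> bool" where
  "assoc_3 False T x y xy zs = False"
| "assoc_3 True T x y xy [] = True"
| "assoc_3 True T x y xy (z # zs) = assoc_3 (mul T xy z = mul T x (mul T y z)) T x y xy zs"

fun assoc_2 :: "bool \<Rightarrow> nat list list \<Rightarrow> nat list \<Rightarrow> nat \<Rightarrow> nat list \<Rightarrow> bool" where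
  "assoc_2 False T es x ys = False"
| "assoc_2 True T es x [] = True"
| "assoc_2 True T es x (y # ys) = assoc_2 (assoc_3 True T x y (mul T x y) es) T es x ys"

fun assoc_1 :: "bool \<Rightarrow> nat list list \<Rightarrow> nat list \<Rightarrow> nat list \<Rightarrow> bool" where
  "assoc_1 False T es xs = False"
| "assoc_1 True T es [] = True"
| "assoc_1 True T es (x # xs) = assoc_1 (assoc_2 True T es x es) T es xs"

lemma assoc_3: "assoc_3 b T x y xy zs \<longleftrightarrow> b \<and> (\<forall>z\<in>set zs. mul T xy z = mul T x (mul T y z))"
  by (induction b T x y xy zs rule: assoc_3.induct) auto

lemma assoc_2: "assoc_2 b T es x ys \<longleftrightarrow> b \<and> (\<forall>y\<in>set ys. \<forall>z\<in>set es. mul T (mul T x y) z = mul T x (mul T y z))"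
  by (induction b T es x ys rule: assoc_2.induct) (auto simp: assoc_3)

lemma assoc_1: "assoc_1 b T es xs \<longleftrightarrow>
    b \<and> (\<forall>x\<in>set xs. \<forall>y\<in>set es. \<forall>z\<in>set es. mul T (mul T x y) z = mul T x (mul T y z))"
  by (induction b T es xs rule: assoc_1.induct) (auto simp: assoc_2)

fun row_ok :: "nat \<Rightarrow> nat list \<Rightarrow> bool" where
  "row_ok n r \<longleftrightarrow> length r = n \<and> list_all (\<lambda>x. x < n) r"

text \<open>A Cayley table with neutral element \<open>0\<close>, together with the list of inverses.\<close>

fun group_table :: "nat list list \<times> nat list \<Rightarrow> bool" where
  "group_table (T, is) \<longleftrightarrow> T \<noteq> [] \<and> list_all (row_ok (length T)) T \<and> row_ok (length T) is \<and>
     hd T = [0..<length T] \<and> assoc_1 True T (hd T) (hd T) \<and>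
     list_all (\<lambda>x. mul T (at is x) x = 0) (hd T)"

datatype var = VA1 | VA2 | VB1 | VB2

text \<open>Values of the \<open>A\<close>-letters and of the \<open>B\<close>-letters; inverses are
  stored alongside, so a relator costs only table lookups.\<close>

datatype env = Env "nat quad" "nat quad"

fun upd :: "env \<Rightarrow> var \<Rightarrow> nat \<times> nat \<Rightarrow> env" where
  "upd (Env (Quad a b c d) q) VA1 (x, x') = Env (Quad x x' c d) q"
| "upd (Env (Quad a b c d) q) VA2 (x, x') = Env (Quad a b x x') q"
| "upd (Env p (Quad a b c d)) VB1 (x, x') = Env p (Quad x x' c d)"
| "upd (Env p (Quad a b c d)) VB2 (x, x') = Env p (Quad a b x x')"

fun half :: "nat list list \<Rightarrow> env \<Rightarrow> code \<Rightarrow> code \<Rightarrow> nat" where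
  "half T (Env p q) a b = mul T (get p a) (get q b)"

fun get_A :: "env \<Rightarrow> code \<Rightarrow> nat" where
  "get_A (Env p q) c = get p c"

text \<open>The number is the value of the last relator, so that \<open>0\<close> means that it holds.\<close>

fun hold :: "nat \<Rightarrow> nat list list \<Rightarrow> env \<Rightarrow> square list \<Rightarrow> bool" where
  "hold (Suc n) T e ws = False"
| "hold 0 T e [] = True"
| "hold 0 T e ((a, b, c, d) # ws) = hold (mul T (half T e a b) (half T e c d)) T e ws"

text \<open>With a relator at hand whose last letter is the new generator, the only candidate is the
  inverse of the product of the first three letters. Its own inverse, the second component, is that
  product.\<close>

fun candidates :: "nat list list \<Rightarrow> nat list \<Rightarrow> (nat \<times> nat) list \<Rightarrow> square list \<Rightarrow> env \<Rightarrow> (nat \<times> nat) list" where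
  "candidates T is es [] e = es"
| "candidates T is es ((a, b, c, d) # w) e =
    [(at is (mul T (half T e a b) (get_A e c)), mul T (half T e a b) (get_A e c))]"

fun count_if :: "(env \<Rightarrow> nat \<Rightarrow> nat) \<Rightarrow> bool \<Rightarrow> env \<Rightarrow> nat \<Rightarrow> nat" where
  "count_if f True e k = f e k"
| "count_if f False e k = k"

primrec count_loop :: "(env \<Rightarrow> nat \<Rightarrow> nat) \<Rightarrow> nat list list \<Rightarrow> var \<Rightarrow> square list \<Rightarrow> env \<Rightarrow> (nat \<times> nat) list \<Rightarrow> nat \<Rightarrow> nat" where
  "count_loop f T v R e [] k = k"
| "count_loop f T v R e (x # xs) k = count_loop f T v R e xs (count_if f (hold 0 T (upd e v x) R) (upd e v x) k)"

text \<open>In a level \<open>(v, R, S)\<close> the variable \<open>v\<close> receives a value,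
  \<open>R\<close> holds the relators tested at that point, and \<open>S\<close> those from which
  the value can be solved.\<close>

fun count :: "nat list list \<Rightarrow> nat list \<Rightarrow> (nat \<times> nat) list \<Rightarrow> (var \<times> square list \<times> square list) list \<Rightarrow> env \<Rightarrow> nat \<Rightarrow> nat" where
  "count T is es [] e k = k + 1"
| "count T is es ((v, R, S) # L) e k = count_loop (count T is es L) T v R e (candidates T is es S e) k"

fun is1 :: "code \<Rightarrow> bool" where
  "is1 P1 = True" | "is1 N1 = True" | "is1 P2 = False" | "is1 N2 = False"

text \<open>The generators receive their values in the order \<open>a\<^sub>1, b\<^sub>1, a\<^sub>2, b\<^sub>2\<close>; a relator is tested as soon as all its
  letters have a value.\<close>

definition R2 :: "square list \<Rightarrow> square list" where
  "R2 ws = filter (\<lambda>(a, b, c, d). is1 a \<and> is1 b \<and> is1 c \<and> is1 d) ws"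

definition R3 :: "square list \<Rightarrow> square list" where
  "R3 ws = filter (\<lambda>(a, b, c, d). \<not> (is1 a \<and> is1 c) \<and> is1 b \<and> is1 d) ws"

definition R4 :: "square list \<Rightarrow> square list" where
  "R4 ws = filter (\<lambda>(a, b, c, d). \<not> (is1 b \<and> is1 d)) ws"

text \<open>If \<open>b\<^sub>2\<close> occurs just once, as the last letter of a relator, its value is determined by the others.\<close>

definition solvable :: "square list \<Rightarrow> square list" where
  "solvable ws = filter (\<lambda>(a, b, c, d). is1 b \<and> d = P2) (R4 ws)"

definition levels :: "square list \<Rightarrow> (var \<times> square list \<times> square list) list" where
  "levels ws = [(VA1, [], []), (VB1, R2 ws, []), (VA2, R3 ws, []), (VB2, R4 ws, solvable ws)]"

text \<open>Placeholders, to be overwritten before any relator reads them.\<close>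

definition zero_env :: env where
  "zero_env = Env (Quad 0 0 0 0) (Quad 0 0 0 0)"

fun hom_count :: "nat list list \<times> nat list \<Rightarrow> square list \<Rightarrow> nat" where
  "hom_count (T, is) ws = count T is (zip (hd T) is) (levels ws) zero_env 0"

section \<open>Correctness of the counting procedure\<close>

locale cayley =
  fixes T :: "nat list list" and "is" :: "nat list"
  assumes table: "group_table (T, is)"
begin

abbreviation Q :: "nat monoid" where "Q \<equiv> table_group T"

lemma rows: "x < length T \<Longrightarrow> row_ok (length T) (T ! x)" "row_ok (length T) is" "0 < length T"
  using table by (simp_all add: list_all_length del: row_ok.simps)

lemma elems: "hd T = [0..<length T]" "T ! 0 = [0..<length T]"
  using table hd_conv_nth[of T] by (simp_all del: row_ok.simps)

lemma row_ok_at: "row_ok n r \<Longrightarrow> x < n \<Longrightarrow> at r x = r ! x \<and> r ! x < n"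
  by (simp add: list_all_length at_nth)

lemma at_table: "x < length T \<Longrightarrow> at T x = T ! x"
  by (rule at_nth)

lemma mul_closed: "x < length T \<Longrightarrow> y < length T \<Longrightarrow> mul T x y < length T"
  using row_ok_at[OF rows(1)] by (simp add: mul_def at_table)

lemma inverse_closed: "x < length T \<Longrightarrow> at is x < length T"
  using row_ok_at[OF rows(2)] by simp

lemma mul_inverse: "x < length T \<Longrightarrow> mul T (at is x) x = 0"
  using table elems by (simp add: list_all_iff)

lemma mul_assoc: "x < length T \<Longrightarrow> y < length T \<Longrightarrow> z < length T \<Longrightarrow> mul T (mul T x y) z = mul T x (mul T y z)"
  using table elems by (simp add: assoc_1)

lemma mul_0: "x < length T \<Longrightarrow> mul T 0 x = x"
  using rows(3) elems by (simp add: mul_def at_nth)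

lemma group_Q: "group Q"
proof (rule groupI)
  show "\<exists>y\<in>carrier Q. y \<otimes>\<^bsub>Q\<^esub> x = \<one>\<^bsub>Q\<^esub>" if "x \<in> carrier Q" for x
    using that inverse_closed[of x] mul_inverse[of x] by (auto simp: table_group_def)
qed (use mul_closed mul_assoc mul_0 rows(3) in \<open>simp_all add: table_group_def\<close>)

sublocale Q: group Q by (rule group_Q)

lemma carrier_Q [simp]: "x \<in> carrier Q \<longleftrightarrow> x < length T" by (simp add: table_group_def)
lemma mult_Q: "x \<otimes>\<^bsub>Q\<^esub> y = mul T x y" by (simp add: table_group_def)
lemma one_Q: "\<one>\<^bsub>Q\<^esub> = 0" by (simp add: table_group_def)

lemma inv_Q: "x < length T \<Longrightarrow> inv\<^bsub>Q\<^esub> x = at is x"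
  using inverse_closed[of x] mul_inverse[of x] by (intro Q.inv_equality) (simp_all add: mult_Q one_Q)

lemma zip_elems: "zip (hd T) is = map (\<lambda>x. (x, inv\<^bsub>Q\<^esub> x)) [0..<length T]"
proof -
  have "length is = length T" using rows(2) by simp
  then show ?thesis
    unfolding elems by (intro nth_equalityI) (simp_all add: inv_Q at_nth)
qed

lemma hold_iff: "hold n T e ws \<longleftrightarrow> n = 0 \<and> (\<forall>(a, b, c, d)\<in>set ws. mul T (half T e a b) (half T e c d) = 0)"
  by (induction n T e ws rule: hold.induct) auto

fun well_formed :: "env \<Rightarrow> bool" where
  "well_formed (Env p q) \<longleftrightarrow> (\<forall>c. get p c < length T \<and> get q c < length T)"

text \<open>The reference version of \<open>count\<close>: every variable runs through the whole
  group, without the shortcut by \<open>S\<close>.\<close>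

primrec total_count :: "(var \<times> square list \<times> square list) list \<Rightarrow> env \<Rightarrow> nat" where
  "total_count [] e = 1"
| "total_count (l # L) e = (case l of (v, R, S) \<Rightarrow>
    \<Sum>x<length T. if hold 0 T (upd e v (x, inv\<^bsub>Q\<^esub> x)) R then total_count L (upd e v (x, inv\<^bsub>Q\<^esub> x)) else 0)"

text \<open>The hypothesis is confined to environments that the loop visits, because
  \<open>count_eq\<close> is available only for well-formed ones.\<close>

lemma count_loop_sum:
  assumes "\<And>e k. e \<in> upd e0 v ` set xs \<Longrightarrow> f e k = k + g e"
  shows "count_loop f T v R e0 xs k = k + (\<Sum>x\<leftarrow>xs. if hold 0 T (upd e0 v x) R then g (upd e0 v x) else 0)"
  using assms
proof (induction xs arbitrary: k)
  case (Cons x xs)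
  then show ?case by (cases "hold 0 T (upd e0 v x) R") auto
qed simp

text \<open>The shortcut is lossless when the solved relator is also tested and the new generator
  occurs in it only as the last letter.\<close>

fun solves :: "var \<times> square list \<times> square list \<Rightarrow> bool" where
  "solves (v, R, S) \<longleftrightarrow> S = [] \<or> (\<exists>a b c. hd S = (a, b, c, P2) \<and> hd S \<in> set R \<and> is1 b \<and> v = VB2)"

lemma well_formed_upd: "well_formed e \<Longrightarrow> x < length T \<Longrightarrow> x' < length T \<Longrightarrow> well_formed (upd e v (x, x'))"
proof -
  assume *: "well_formed e" "x < length T" "x' < length T"
  obtain A1 A2 A3 A4 B1 B2 B3 B4 where e: "e = Env (Quad A1 A2 A3 A4) (Quad B1 B2 B3 B4)"
    by (metis env.exhaust quad.exhaust)
  have all: "(\<forall>c. R c) \<longleftrightarrow> R P1 \<and> R N1 \<and> R P2 \<and> R N2" for R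
    by (rule iffI) (simp, metis code.exhaust)
  show ?thesis using * unfolding e by (cases v) (auto simp: all)
qed

text \<open>The tested relator forces the value of the new generator, so every other summand of the
  full sum vanishes.\<close>

lemma sum_candidates:
  assumes e: "well_formed e" and S: "solves (v, R, S)"
  shows "(\<Sum>x\<leftarrow>candidates T is (zip (hd T) is) S e. if hold 0 T (upd e v x) R then g (upd e v x) else 0) =
    (\<Sum>x<length T. if hold 0 T (upd e v (x, inv\<^bsub>Q\<^esub> x)) R then g (upd e v (x, inv\<^bsub>Q\<^esub> x)) else (0 :: nat))"
proof (cases S)
  case Nil
  then show ?thesis
    by (simp add: zip_elems o_def sum_list_distinct_conv_sum_set atLeast0LessThan)
next
  case (Cons s S')
  then obtain a b c where s: "s = (a, b, c, P2)" "s \<in> set R" "is1 b" "v = VB2" using S by auto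
  obtain p B1 B2 B3 B4 where e_eq: "e = Env p (Quad B1 B2 B3 B4)" by (metis env.exhaust quad.exhaust)
  define y where "y = mul T (half T e a b) (get p c)"
  have half: "half T (upd e VB2 xx) a b = half T e a b" "half T (upd e VB2 xx) c P2 = mul T (get p c) (fst xx)" for xx
    using s(3) by (cases b; cases xx; simp add: e_eq)+
  have "get p x < length T \<and> get (Quad B1 B2 B3 B4) x < length T" for x
    using e unfolding e_eq well_formed.simps by blast
  then have closed: "half T e a b < length T" "get p c < length T"
    unfolding e_eq half.simps by (blast intro: mul_closed)+
  then have "y < length T" unfolding y_def by (rule mul_closed)
  note closed = closed this
  have y: "inv\<^bsub>Q\<^esub> (inv\<^bsub>Q\<^esub> y) = y" "inv\<^bsub>Q\<^esub> y < length T"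
    using closed(3) Q.inv_inv[unfolded carrier_Q, of y] Q.inv_closed[unfolded carrier_Q, of y] by blast+
  have only: "x = inv\<^bsub>Q\<^esub> y" if "x < length T" "hold 0 T (upd e v (x, inv\<^bsub>Q\<^esub> x)) R" for x
  proof -
    have "mul T (half T e a b) (mul T (get p c) x) = 0"
      using that(2) s half by (fastforce simp: hold_iff)
    then have "y \<otimes>\<^bsub>Q\<^esub> x = \<one>\<^bsub>Q\<^esub>"
      using Q.m_assoc[unfolded carrier_Q mult_Q, OF closed(1,2) that(1)] by (simp add: y_def mult_Q one_Q)
    then have "x \<otimes>\<^bsub>Q\<^esub> y = \<one>\<^bsub>Q\<^esub>"
      by (rule Q.inv_comm) (use closed that in simp_all)
    then show ?thesis
      by (rule Q.inv_equality[symmetric]) (use closed that in simp_all)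
  qed
  have "(\<Sum>x<length T. if hold 0 T (upd e v (x, inv\<^bsub>Q\<^esub> x)) R then g (upd e v (x, inv\<^bsub>Q\<^esub> x)) else 0) =
      (\<Sum>x\<in>{inv\<^bsub>Q\<^esub> y}. if hold 0 T (upd e v (x, inv\<^bsub>Q\<^esub> x)) R then g (upd e v (x, inv\<^bsub>Q\<^esub> x)) else 0)"
  proof (rule sum.mono_neutral_right)
    show "\<forall>x\<in>{..<length T} - {inv\<^bsub>Q\<^esub> y}. (if hold 0 T (upd e v (x, inv\<^bsub>Q\<^esub> x)) R then g (upd e v (x, inv\<^bsub>Q\<^esub> x)) else 0) = 0"
    proof
      fix x assume "x \<in> {..<length T} - {inv\<^bsub>Q\<^esub> y}"
      then have "\<not> hold 0 T (upd e v (x, inv\<^bsub>Q\<^esub> x)) R" using only by blast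
      then show "(if hold 0 T (upd e v (x, inv\<^bsub>Q\<^esub> x)) R then g (upd e v (x, inv\<^bsub>Q\<^esub> x)) else 0) = 0" by simp
    qed
  qed (use y in auto)
  moreover have "candidates T is (zip (hd T) is) S e = [(inv\<^bsub>Q\<^esub> y, y)]"
    using Cons s closed inv_Q[of y] by (simp add: y_def e_eq)
  ultimately show ?thesis using y by simp
qed

lemma count_eq:
  "well_formed e \<Longrightarrow> list_all solves L \<Longrightarrow> count T is (zip (hd T) is) L e k = k + total_count L e"
proof (induction L arbitrary: e k)
  case (Cons l L)
  obtain v R S where l: "l = (v, R, S)" by (cases l)
  have S: "solves (v, R, S)" using Cons.prems l by simp
  have wf: "well_formed e'" if e': "e' \<in> upd e v ` set (candidates T is (zip (hd T) is) S e)" for e'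
  proof -
    obtain x x' where x: "e' = upd e v (x, x')" "(x, x') \<in> set (candidates T is (zip (hd T) is) S e)" using e' by auto
    have "x < length T \<and> x' < length T"
    proof (cases S)
      case Nil
      then show ?thesis using x(2) Q.inv_closed by (auto simp: zip_elems)
    next
      case (Cons s S')
      obtain a b c d where s: "s = (a, b, c, d)" by (cases s)
      obtain p q where e: "e = Env p q" by (cases e)
      have "x' < length T" using x(2) Cons s \<open>well_formed e\<close> by (simp add: e mul_closed)
      then show ?thesis using x(2) Cons s inverse_closed by simp
    qed
    then show ?thesis using x(1) \<open>well_formed e\<close> well_formed_upd by simp
  qed
  have "count T is (zip (hd T) is) (l # L) e k = k + (\<Sum>x\<leftarrow>candidates T is (zip (hd T) is) S e.
      if hold 0 T (upd e v x) R then total_count L (upd e v x) else 0)"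
    unfolding l count.simps by (rule count_loop_sum) (use Cons wf in auto)
  then show ?case using sum_candidates[OF Cons.prems(1) S] l by simp
qed simp

fun env_of :: "nat \<times> nat \<times> nat \<times> nat \<Rightarrow> env" where
  "env_of (x1, y1, x2, y2) = Env (Quad x1 (inv\<^bsub>Q\<^esub> x1) x2 (inv\<^bsub>Q\<^esub> x2)) (Quad y1 (inv\<^bsub>Q\<^esub> y1) y2 (inv\<^bsub>Q\<^esub> y2))"

definition rel :: "env \<Rightarrow> square \<Rightarrow> bool" where
  "rel e s = (case s of (a, b, c, d) \<Rightarrow> mul T (half T e a b) (half T e c d) = 0)"

lemma hold_rel: "hold 0 T e ws \<longleftrightarrow> (\<forall>s\<in>set ws. rel e s)"
  by (auto simp: hold_iff rel_def)

lemma solves_levels: "list_all solves (levels ws)"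
proof -
  have "solves (VB2, R4 ws, solvable ws)"
  proof (cases "solvable ws")
    case (Cons s S)
    obtain a b c d where s: "s = (a, b, c, d)" by (cases s)
    have "s \<in> set (solvable ws)" using Cons by simp
    then have "s \<in> set (R4 ws)" "is1 b" "d = P2" by (auto simp: solvable_def s)
    then show ?thesis using Cons s by simp
  qed simp
  then show ?thesis by (simp add: levels_def)
qed

lemma half_is1:
  assumes "is1 a" "is1 b"
  shows "half T (Env (Quad p1 p2 p3 p4) (Quad q1 q2 q3 q4)) a b = half T (Env (Quad p1 p2 p3' p4') (Quad q1 q2 q3' q4')) a b"
  using assms by (cases a; cases b) simp_all

lemma half_is1':
  assumes "is1 b"
  shows "half T (Env p (Quad q1 q2 q3 q4)) a b = half T (Env p (Quad q1 q2 q3' q4')) a b"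
  using assms by (cases b) simp_all

text \<open>Such a relator involves only letters of index 1, so the other entries may be
  placeholders or final values alike.\<close>

lemma rel_R2:
  assumes "s \<in> set (R2 ws)"
  shows "rel (Env (Quad p1 p2 p3 p4) (Quad q1 q2 q3 q4)) s = rel (Env (Quad p1 p2 p3' p4') (Quad q1 q2 q3' q4')) s"
proof -
  obtain a b c d where s: "s = (a, b, c, d)" by (cases s)
  then have "is1 a" "is1 b" "is1 c" "is1 d" using assms by (simp_all add: R2_def)
  then show ?thesis
    using half_is1[of a b p1 p2 p3 p4 q1 q2 q3 q4 p3' p4' q3' q4'] half_is1[of c d p1 p2 p3 p4 q1 q2 q3 q4 p3' p4' q3' q4']
    by (simp add: rel_def s del: half.simps)
qed

lemma rel_R3:
  assumes "s \<in> set (R3 ws)"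
  shows "rel (Env p (Quad q1 q2 q3 q4)) s = rel (Env p (Quad q1 q2 q3' q4')) s"
proof -
  obtain a b c d where s: "s = (a, b, c, d)" by (cases s)
  then have "is1 b" "is1 d" using assms by (simp_all add: R3_def)
  then show ?thesis
    using half_is1'[of b p q1 q2 q3 q4 a q3' q4'] half_is1'[of d p q1 q2 q3 q4 c q3' q4']
    by (simp add: rel_def s del: half.simps)
qed

lemma set_levels: "set ws = set (R2 ws) \<union> set (R3 ws) \<union> set (R4 ws)"
  by (auto simp: R2_def R3_def R4_def)

text \<open>\<open>R2\<close>, \<open>R3\<close> and \<open>R4\<close> together contain all
  relators. A test that fails early only skips summands that are zero, and passing to the final
  environment does not affect earlier tests.\<close>

lemma total_count_levels:
  "total_count (levels ws) zero_env = (\<Sum>x1<length T. \<Sum>y1<length T. \<Sum>x2<length T. \<Sum>y2<length T.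
     if \<forall>s\<in>set ws. rel (env_of (x1, y1, x2, y2)) s then 1 else 0)"
proof -
  have R2: "(\<forall>s\<in>set (R2 ws). rel (Env (Quad x1 (inv\<^bsub>Q\<^esub> x1) 0 0) (Quad y1 (inv\<^bsub>Q\<^esub> y1) 0 0)) s) \<longleftrightarrow>
      (\<forall>s\<in>set (R2 ws). rel (env_of (x1, y1, x2, y2)) s)" for x1 y1 x2 y2
    unfolding env_of.simps by (rule ball_cong[OF HOL.refl]) (rule rel_R2)
  have R3: "(\<forall>s\<in>set (R3 ws). rel (Env (Quad x1 (inv\<^bsub>Q\<^esub> x1) x2 (inv\<^bsub>Q\<^esub> x2)) (Quad y1 (inv\<^bsub>Q\<^esub> y1) 0 0)) s) \<longleftrightarrow>
      (\<forall>s\<in>set (R3 ws). rel (env_of (x1, y1, x2, y2)) s)" for x1 y1 x2 y2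
    unfolding env_of.simps by (rule ball_cong[OF HOL.refl]) (rule rel_R3)
  have push: "(if P then (\<Sum>x2<n. if P' x2 then (\<Sum>y2<n. if P'' x2 y2 then 1 else 0) else 0) else 0) =
      (\<Sum>x2<n. \<Sum>y2<n. if P \<and> P' x2 \<and> P'' x2 y2 then 1 else (0 :: nat))" for P P' P'' n
  proof (cases P)
    case True
    then show ?thesis by (auto intro!: sum.cong)
  qed simp
  have "total_count (levels ws) zero_env = (\<Sum>x1<length T. \<Sum>y1<length T.
      if \<forall>s\<in>set (R2 ws). rel (Env (Quad x1 (inv\<^bsub>Q\<^esub> x1) 0 0) (Quad y1 (inv\<^bsub>Q\<^esub> y1) 0 0)) s then
        (\<Sum>x2<length T. if \<forall>s\<in>set (R3 ws). rel (Env (Quad x1 (inv\<^bsub>Q\<^esub> x1) x2 (inv\<^bsub>Q\<^esub> x2)) (Quad y1 (inv\<^bsub>Q\<^esub> y1) 0 0)) s then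
          (\<Sum>y2<length T. if \<forall>s\<in>set (R4 ws). rel (env_of (x1, y1, x2, y2)) s then 1 else 0) else 0) else 0)"
    by (simp add: levels_def hold_rel zero_env_def cong del: if_weak_cong)
  also have "\<dots> = (\<Sum>x1<length T. \<Sum>y1<length T. \<Sum>x2<length T. \<Sum>y2<length T.
      if \<forall>s\<in>set ws. rel (env_of (x1, y1, x2, y2)) s then 1 else 0)"
    unfolding push set_levels[of ws] ball_Un
    by (intro sum.cong HOL.refl if_cong) (simp only: R2[symmetric] R3[symmetric] conj_assoc)
  finally show ?thesis .
qed

definition gen_vals :: "(gen \<Rightarrow> nat) \<Rightarrow> nat \<times> nat \<times> nat \<times> nat" where
  "gen_vals f = (f (GenA 1), f (GenB 1), f (GenA 2), f (GenB 2))"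

lemma word_val_rel:
  assumes f: "f \<in> gens \<rightarrow> carrier Q"
  shows "word_val Q f (word s) = \<one>\<^bsub>Q\<^esub> \<longleftrightarrow> rel (env_of (gen_vals f)) s"
proof -
  obtain a b c d where s: "s = (a, b, c, d)" by (cases s)
  have vals: "f x < length T" if "x \<in> {GenA 1, GenA 2, GenB 1, GenB 2}" for x
    using f that gens_cases[of x] by auto
  have closed: "lit_val Q f (to_letter l) \<in> carrier Q" for l
    by (rule Q.lit_val_closed[OF f]) (simp add: letters_gens)
  have half: "half T (env_of (gen_vals f)) x y = lit_val Q f (to_letter (A x)) \<otimes>\<^bsub>Q\<^esub> lit_val Q f (to_letter (B y))" for x y
    by (cases x; cases y) (simp_all add: gen_vals_def mult_Q)
  show ?thesis
    unfolding rel_def s prod.case half mult_Q[symmetric] one_Q[symmetric]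
    using closed by (simp add: word_def Q.m_assoc del: carrier_Q)
qed

text \<open>Homomorphisms are relator maps; one word per square suffices to test them, and an
  extensional map on the generators is the same as a quadruple of values.\<close>

lemma hom_count_eq: "hom_count (T, is) ws = card (hom_ext (square_group (set (all_variants ws))) Q)"
proof -
  let ?C = "{..<length T}"
  let ?P = "\<lambda>t. \<forall>s\<in>set ws. rel (env_of t) s"
  have PiE: "f \<in> gens \<rightarrow> carrier Q" if "f \<in> gens \<rightarrow>\<^sub>E carrier Q" for f using that by (auto simp: PiE_def)
  have "card (hom_ext (square_group (set (all_variants ws))) Q) = card (relator_maps gens (word ` set (all_variants ws)) Q)"
    unfolding square_group_def by (rule card_hom_ext_presented_group[OF group_Q word_lists])
  also have "relator_maps gens (word ` set (all_variants ws)) Q =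
      {f \<in> gens \<rightarrow>\<^sub>E carrier Q. \<forall>s\<in>set ws. word_val Q f (word s) = \<one>\<^bsub>Q\<^esub>}"
  proof (intro equalityI subsetI)
    fix f assume f: "f \<in> relator_maps gens (word ` set (all_variants ws)) Q"
    have "s \<in> set (all_variants ws)" if "s \<in> set ws" for s
      using that variants_self[of s] by (auto simp: all_variants_def simp del: variants.simps)
    then show "f \<in> {f \<in> gens \<rightarrow>\<^sub>E carrier Q. \<forall>s\<in>set ws. word_val Q f (word s) = \<one>\<^bsub>Q\<^esub>}"
      using f by (simp add: relator_maps_def)
  next
    fix f assume f: "f \<in> {f \<in> gens \<rightarrow>\<^sub>E carrier Q. \<forall>s\<in>set ws. word_val Q f (word s) = \<one>\<^bsub>Q\<^esub>}"
    have "word_val Q f (word t) = \<one>\<^bsub>Q\<^esub>" if t: "t \<in> set (all_variants ws)" for t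
    proof -
      obtain s where "s \<in> set ws" "t \<in> set (variants s)"
        using t by (auto simp: all_variants_def simp del: variants.simps)
      then show ?thesis using f Q.word_val_variants[OF PiE] by blast
    qed
    then show "f \<in> relator_maps gens (word ` set (all_variants ws)) Q"
      using f by (simp add: relator_maps_def)
  qed
  also have "\<dots> = {f \<in> gens \<rightarrow>\<^sub>E carrier Q. ?P (gen_vals f)}"
    using word_val_rel[OF PiE] by blast
  also have "card \<dots> = card {t \<in> ?C \<times> ?C \<times> ?C \<times> ?C. ?P t}"
  proof (rule bij_betw_same_card[OF bij_betw_byWitness])
    \<comment> \<open>The extensional map with prescribed values, in the order of
      \<open>gen_vals\<close>.\<close>
    define w where "w = (\<lambda>(x1, y1, x2, y2). \<lambda>x\<in>gens.
      case x of GenA n \<Rightarrow> (if n = 1 then x1 else x2) | GenB n \<Rightarrow> (if n = 1 then y1 else (y2 :: nat)))"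
    have in_gens [simp]: "GenA 1 \<in> gens" "GenA 2 \<in> gens" "GenB 1 \<in> gens" "GenB 2 \<in> gens"
      by (simp_all add: gens_cases)
    show w_values: "\<forall>f\<in>{f \<in> gens \<rightarrow>\<^sub>E carrier Q. ?P (gen_vals f)}. w (gen_vals f) = f"
    proof
      fix f assume "f \<in> {f \<in> gens \<rightarrow>\<^sub>E carrier Q. ?P (gen_vals f)}"
      then have f: "f \<in> extensional gens" by (auto simp: PiE_def)
      show "w (gen_vals f) = f"
        by (rule extensionalityI[OF _ f]) (auto simp: w_def gen_vals_def gens_cases)
    qed
    have values_w: "gen_vals (w t) = t" for t
      by (cases t) (simp add: w_def gen_vals_def gens_cases)
    then show "\<forall>t\<in>{t \<in> ?C \<times> ?C \<times> ?C \<times> ?C. ?P t}. gen_vals (w t) = t" by simp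
    show "gen_vals ` {f \<in> gens \<rightarrow>\<^sub>E carrier Q. ?P (gen_vals f)} \<subseteq> {t \<in> ?C \<times> ?C \<times> ?C \<times> ?C. ?P t}"
    proof clarsimp
      fix f assume "f \<in> gens \<rightarrow>\<^sub>E carrier Q"
      then have "f x < length T" if "x \<in> gens" for x using that carrier_Q by (auto simp: PiE_iff)
      then show "gen_vals f \<in> ?C \<times> ?C \<times> ?C \<times> ?C" by (simp add: gen_vals_def del: One_nat_def)
    qed
    show "w ` {t \<in> ?C \<times> ?C \<times> ?C \<times> ?C. ?P t} \<subseteq> {f \<in> gens \<rightarrow>\<^sub>E carrier Q. ?P (gen_vals f)}"
    proof clarify
      fix x1 y1 x2 y2 assume *: "x1 < length T" "y1 < length T" "x2 < length T" "y2 < length T" "?P (x1, y1, x2, y2)"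
      then have "w (x1, y1, x2, y2) \<in> gens \<rightarrow>\<^sub>E carrier Q"
        by (auto simp: w_def gens_cases)
      then show "w (x1, y1, x2, y2) \<in> gens \<rightarrow>\<^sub>E carrier Q \<and> ?P (gen_vals (w (x1, y1, x2, y2)))"
        using * values_w by simp
    qed
  qed
  also have "\<dots> = (\<Sum>t\<in>?C \<times> ?C \<times> ?C \<times> ?C. if ?P t then 1 else 0)"
    by (simp add: sum.If_cases Int_def)
  also have "\<dots> = total_count (levels ws) zero_env"
    unfolding total_count_levels sum.cartesian_product by (intro sum.cong) auto
  also have "\<dots> = hom_count (T, is) ws"
  proof -
    have "get (Quad 0 0 0 0) c = (0 :: nat)" for c by (cases c) simp_all
    then have "well_formed zero_env" using rows(3) by (simp add: zero_env_def)
    then show ?thesis using count_eq[OF _ solves_levels] by simp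
  qed
  finally show ?thesis by simp
qed

end

section \<open>Separating the representatives\<close>

text \<open>For \<open>(n, m, r, t) = (3,1,1,0), (3,2,2,0), (4,2,3,2), (3,4,2,0), (5,4,2,0)\<close> the group with presentation
  \<open>\<langle>x, y | x\<^sup>n = 1, y\<^sup>m = x\<^sup>t, y x y\<^sup>-\<^sup>1 = x\<^sup>r\<rangle>\<close>, where \<open>x\<^sup>i y\<^sup>j\<close> has index \<open>i + n j\<close>.\<close>

definition cayley_tables :: "(nat list list \<times> nat list) list" where
  "cayley_tables = [
    ([[0,1,2],[1,2,0],[2,0,1]],
     [0,2,1]),
    ([[0,1,2,3,4,5],[1,2,0,4,5,3],[2,0,1,5,3,4],[3,5,4,0,2,1],[4,3,5,1,0,2],[5,4,3,2,1,0]],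
     [0,2,1,3,4,5]),
    ([[0,1,2,3,4,5,6,7],[1,2,3,0,5,6,7,4],[2,3,0,1,6,7,4,5],[3,0,1,2,7,4,5,6],[4,7,6,5,2,1,0,3],
      [5,4,7,6,3,2,1,0],[6,5,4,7,0,3,2,1],[7,6,5,4,1,0,3,2]],
     [0,3,2,1,6,7,4,5]),
    ([[0,1,2,3,4,5,6,7,8,9,10,11],[1,2,0,4,5,3,7,8,6,10,11,9],[2,0,1,5,3,4,8,6,7,11,9,10],
      [3,5,4,6,8,7,9,11,10,0,2,1],[4,3,5,7,6,8,10,9,11,1,0,2],[5,4,3,8,7,6,11,10,9,2,1,0],
      [6,7,8,9,10,11,0,1,2,3,4,5],[7,8,6,10,11,9,1,2,0,4,5,3],[8,6,7,11,9,10,2,0,1,5,3,4],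
      [9,11,10,0,2,1,3,5,4,6,8,7],[10,9,11,1,0,2,4,3,5,7,6,8],[11,10,9,2,1,0,5,4,3,8,7,6]],
     [0,2,1,9,10,11,6,8,7,3,4,5]),
    ([[0,1,2,3,4,5,6,7,8,9,10,11,12,13,14,15,16,17,18,19],[1,2,3,4,0,6,7,8,9,5,11,12,13,14,10,16,17,18,19,15],
      [2,3,4,0,1,7,8,9,5,6,12,13,14,10,11,17,18,19,15,16],[3,4,0,1,2,8,9,5,6,7,13,14,10,11,12,18,19,15,16,17],
      [4,0,1,2,3,9,5,6,7,8,14,10,11,12,13,19,15,16,17,18],[5,7,9,6,8,10,12,14,11,13,15,17,19,16,18,0,2,4,1,3],
      [6,8,5,7,9,11,13,10,12,14,16,18,15,17,19,1,3,0,2,4],[7,9,6,8,5,12,14,11,13,10,17,19,16,18,15,2,4,1,3,0],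
      [8,5,7,9,6,13,10,12,14,11,18,15,17,19,16,3,0,2,4,1],[9,6,8,5,7,14,11,13,10,12,19,16,18,15,17,4,1,3,0,2],
      [10,14,13,12,11,15,19,18,17,16,0,4,3,2,1,5,9,8,7,6],[11,10,14,13,12,16,15,19,18,17,1,0,4,3,2,6,5,9,8,7],
      [12,11,10,14,13,17,16,15,19,18,2,1,0,4,3,7,6,5,9,8],[13,12,11,10,14,18,17,16,15,19,3,2,1,0,4,8,7,6,5,9],
      [14,13,12,11,10,19,18,17,16,15,4,3,2,1,0,9,8,7,6,5],[15,18,16,19,17,0,3,1,4,2,5,8,6,9,7,10,13,11,14,12],
      [16,19,17,15,18,1,4,2,0,3,6,9,7,5,8,11,14,12,10,13],[17,15,18,16,19,2,0,3,1,4,7,5,8,6,9,12,10,13,11,14],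
      [18,16,19,17,15,3,1,4,2,0,8,6,9,7,5,13,11,14,12,10],[19,17,15,18,16,4,2,0,3,1,9,7,5,8,6,14,12,10,13,11]],
     [0,4,3,2,1,15,17,19,16,18,10,11,12,13,14,5,8,6,9,7])]"

text \<open>The functions \<open>at\<close> and \<open>hold\<close> match on \<open>0\<close> and
  \<open>Suc\<close>, so the code equation spells all entries in unary.\<close>

lemmas [code] = cayley_tables_def[unfolded numeral_eq_Suc pred_numeral_simps BitM.simps One_nat_def]

lemma group_tables: "list_all group_table cayley_tables" by code_simp

text \<open>Initial segments (in reverse order) of homomorphism counts that occur for several representatives,
  so that counting must go on.\<close>

definition ambiguous :: "nat list list" where
  "ambiguous =
    [[1], [3], [9], [27], [18, 3], [42, 3], [54, 3], [54, 9], [78, 3], [78, 9], [114, 3], [114, 9], [32,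
     42, 3], [128, 54, 3], [128, 54, 9], [320, 78, 9], [640, 114, 9], [48, 32, 42, 3], [288, 128, 54, 9]]"

text \<open>The continuation \<open>f\<close> is passed unapplied: further counts are computed only
  if the present ones are shared by several representatives.\<close>

definition extend_signature :: "nat list list \<Rightarrow> (nat list \<Rightarrow> nat list) \<Rightarrow> nat list \<Rightarrow> nat list" where
  "extend_signature am f p = (if p \<in> set am then f p else p)"

primrec signature :: "nat list list \<Rightarrow> square list \<Rightarrow> (nat list list \<times> nat list) list \<Rightarrow> nat list \<Rightarrow> nat list" where
  "signature am ws [] p = p"
| "signature am ws (q # qs) p = extend_signature am (signature am ws qs) (hom_count q ws # p)"

text \<open>Stopping early is harmless for invariance, since the decision depends on the counts
  alone and these agree for isomorphic groups.\<close>

lemma signature_iso: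
  assumes iso: "square_group (set (all_variants vs)) \<cong> square_group (set (all_variants ws))"
  shows "list_all group_table qs \<Longrightarrow> signature am vs qs p = signature am ws qs p"
proof (induction qs arbitrary: p)
  case (Cons q qs)
  obtain T "is" where q: "q = (T, is)" by (cases q)
  interpret cayley T "is" by standard (use Cons.prems q in \<open>simp del: group_table.simps\<close>)
  have "hom_count q vs = hom_count q ws"
    unfolding q hom_count_eq by (rule card_hom_ext_iso[OF iso group_square_group group_square_group])
  then show ?case using Cons by (simp add: extend_signature_def)
qed simp

lemma distinct_signatures: "distinct (map (\<lambda>ws. signature ambiguous ws cayley_tables []) reps)"
  by code_simp

lemma length_reps: "length reps = 41" by code_simp

abbreviation rep_group :: "square list \<Rightarrow> gen letter list set monoid" where
  "rep_group ws \<equiv> square_group (set (all_variants ws))"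

lemma rep_group_iso_eq:
  assumes "vs \<in> set reps" "ws \<in> set reps" "rep_group vs \<cong> rep_group ws"
  shows "vs = ws"
  using signature_iso[OF assms(3) group_tables] distinct_signatures assms(1,2)
  by (auto simp: distinct_map inj_on_def)

lemma BM_group_rep_group:
  assumes "ws \<in> set reps"
  shows "BM_group 2 2 (rep_group ws)"
proof -
  have "length ws = 4" "total (table_of ws)" using assms reps_ok by (simp_all add: list_all_iff)
  then obtain R where "BM_relation 2 2 R" "\<Union>R = word ` set (all_variants ws)"
    using BM_relation_squares all_variants_total by metis
  then show ?thesis
    unfolding BM_group_def using group_square_group iso_refl square_group_def gens_def by metis
qed

lemma valid_iso_rep:
  assumes V: "valid V"
  shows "\<exists>ws\<in>set reps. square_group V \<cong> rep_group ws"
proof -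
  obtain r S where r: "r \<in> set (map fst orbits)" and S: "is_sym S" "sym_square S ` set r \<subseteq> V"
    using search_classifies[OF V list_all_is_sym search_orbits] by blast
  obtain k \<sigma> \<tau> where "(r, k, \<sigma>, \<tau>) \<in> set orbits" using r by auto
  then have k: "k < length reps" and isos: "isos (table_of r) (table_of (reps ! k)) r (reps ! k) \<sigma> \<tau>"
    using list_all_orbit_ok by (auto simp: list_all_iff)
  have "total (table_of r)" using isos by (simp add: isos_def)
  then have "square_group V \<cong> rep_group r"
    using group.iso_sym[OF group_square_group square_group_sym_iso[OF V S]] by blast
  also have "rep_group r \<cong> rep_group (reps ! k)" by (rule isos_iso[OF isos])
  finally (iso_trans) show ?thesis using k nth_mem by blast
qed

text \<open>The number of isomorphism classes is expressed by a transversal. Its members live on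
  classes of words, whereas the groups to be classified may live on any type.\<close>

theorem corollary10:
  "\<exists>\<G> :: gen letter list set monoid set.
     card \<G> = 41 \<and>
     (\<forall>G\<in>\<G>. BM_group 2 2 G) \<and>
     (\<forall>G\<in>\<G>. \<forall>H\<in>\<G>. G \<cong> H \<longrightarrow> G = H) \<and>
     (\<forall>H :: 'g monoid. BM_group 2 2 H \<longrightarrow> (\<exists>G\<in>\<G>. H \<cong> G))"
proof (intro exI conjI)
  let ?G = "rep_group ` set reps"
  have "inj_on rep_group (set reps)"
    \<comment> \<open>Equal groups are isomorphic, so the separation of representatives also gives
      injectivity.\<close>
    by (rule inj_onI) (metis iso_refl rep_group_iso_eq)
  moreover have "card (set reps) = 41"
    using distinct_signatures length_reps by (simp add: distinct_map distinct_card)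
  ultimately show "card ?G = 41" by (simp add: card_image)
  show "\<forall>G\<in>?G. BM_group 2 2 G" using BM_group_rep_group by blast
  show "\<forall>G\<in>?G. \<forall>H\<in>?G. G \<cong> H \<longrightarrow> G = H" using rep_group_iso_eq by blast
  show "\<forall>H :: 'g monoid. BM_group 2 2 H \<longrightarrow> (\<exists>G\<in>?G. H \<cong> G)"
  proof (intro allI impI)
    fix H :: "'g monoid" assume "BM_group 2 2 H"
    then obtain R where R: "BM_relation 2 2 R" "H \<cong> presented_group gens (\<Union>R)"
      unfolding BM_group_def gens_def by blast
    obtain V where V: "\<Union>R = word ` V" "valid V" using BM_relation_valid[OF R(1)] .
    obtain ws where "ws \<in> set reps" "square_group V \<cong> rep_group ws" using valid_iso_rep[OF V(2)] by blast
    then show "\<exists>G\<in>?G. H \<cong> G"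
      using iso_trans[OF R(2)[unfolded V(1), folded square_group_def]] by blast
  qed
qed

end
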